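(* Let $k\ge 5$ and $n$ be integers. Assume that exactly one representative $G$ of each isomorphism class of connected cubic graphs with $n-6$ vertices, with deficit $d(k,G)$ at most $4$ and girth at least $k-2$ (in case $k\in\{5,6\}$) or girth at least $k-1$ (in case $k\ge 7$), is given. Apply the following steps to the given graphs: (1) for each given graph, apply the $\mathcal{H}$ insertion operation to one edge-quadruple in every equivalence class of eligible edge-quadruples; (2) accept each resulting graph with $n$ vertices if and only if the inserted $\mathcal{H}$ has minimal value of $(x_0,\dots,x_6)$ (in lexicographic order) among all reducible $\mathcal{H}$'s of the resulting graph. Then exactly one representative of each isomorphism class of connected cubic graphs with $n$ vertices and girth at least $k$ is accepted.
   Context: Graphs are finite and simple. A cubic graph is a $3$-regular graph; the girth is the length of a shortest cycle. Two subgraphs are disjoint if they have no common vertices. An edge-quadruple is a set $\{\{e_1,e_2\},\{e_3,e_4\}\}$ of two sets, each containing two edges, with all four edges pairwise different. An $\mathcal{H}$ graph is a tree with $6$ vertices having $2$ adjacent vertices of degree $3$ (and $4$ leaves, its endvertices); the edge joining the two vertices of degree $3$ is its central edge. The $\mathcal{H}$ (insertion/expansion) operation applied to an edge-quadruple $\{\{e_1,e_2\},\{e_3,e_4\}\}$ of a cubic graph subdivides each $e_i$ with a new vertex $v_i$, and adds two new adjacent vertices $a,b$ with $a$ adjacent to $v_1,v_2$ and $b$ adjacent to $v_3,v_4$; this yields a cubic graph with $6$ more vertices. The inserted $\mathcal{H}$ is the one on $a,b,v_1,\dots,v_4$, with central edge $\{a,b\}$. In a cubic graph an $\mathcal{H}$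 is uniquely identified by its central edge. The $\mathcal{H}$ reduction is the inverse operation: delete both vertices of the central edge and replace each of the four endvertices, which then has degree $2$, together with its two incident edges by a single edge. An edge $\{x,y\}$ of a connected graph $G$ is good if the subgraph induced by $V(G)\setminus\{x,y\}$ is connected. An $\mathcal{H}$ is reducible if its central edge is good and each cycle containing $i$ endvertices of the $\mathcal{H}$ has length at least $3+i$. For a cycle $C$, the deficit is $d(k,C)=\max(k-|C|,0)$. For a graph $G$, the deficit is $d(k,G)=\max\{\sum_{c\in \mathcal C} d(k,c) \mid \mathcal C \text{ is a set of pairwise disjoint cycles of } G\}$. An edge-quadruple is eligible if applying the $\mathcal{H}$ operation to it destroys all cycles of size smaller than $k$ without creating any new cycles of size smaller than $k$ (i.e. the expanded graph has girth at least $k$). Two edge-quadruples $\{\{e_1,e_2\},\{e_3,e_4\}\}$ and $\{\{e_1',e_2'\},\{e_3',e_4'\}\}$ of a graph are equivalent if there is an automorphism of the graph mapping the set $\{\{e_1,e_2\},\{e_3,e_4\}\}$ to the set $\{\{e_1',e_2'\},\{e_3',e_4'\}\}$. To the central edge $e_c$ of every reducible $\mathcal{H}$ of a graph $G$ one assigns the $7$-tuple $(x_0,\dots,x_6)$, where: $x_0$ is the number of hexagons ($6$-cycles) containing $e_c$; $x_1$ is the number of neighbours of $e_c$ (vertices not in $e_c$ adjacent to a vertex of $e_c$) which are part of a hexagon not containing $e_c$; $x_2$ is the number of heptagons ($7$-cycles) containing $e_c$; $x_3$ is the number of vertices at distance at most $3$ from a vertex in $e_c$; $x_4$ is the number of vertices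 at distance at most $4$ from a vertex in $e_c$; and $x_5<x_6$ are the labels, in a canonical labelling of $G$, of the endpoints of the lexicographically smallest edge in the same orbit of $\operatorname{Aut}(G)$ as $e_c$ (edges being ordered lexicographically by their increasing pair of labels). Here a canonical labelling is fixed once and for all: a function assigning to every graph $G$ a bijection from $V(G)$ to $\{0,\dots,|V(G)|-1\}$ such that the relabelled graphs of any two isomorphic graphs are identical. Tuples are compared lexicographically. *)

theory Defs
  imports Main "HOL-Library.Extended_Nat" "HOL-Library.Product_Lexorder"
begin

datatype 'a graph = Graph (verts: "'a set") (edges: "'a set set")

definition simple_graph :: "'a graph \<Rightarrow> bool" where
  "simple_graph G \<longleftrightarrow> finite (verts G) \<and> (\<forall>e\<in>edges G. e \<subseteq> verts G \<and> card e = 2)"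

definition subgraph :: "'a graph \<Rightarrow> 'a graph \<Rightarrow> bool" where
  "subgraph H G \<longleftrightarrow> verts H \<subseteq> verts G \<and> edges H \<subseteq> edges G"

definition induced :: "'a graph \<Rightarrow> 'a set \<Rightarrow> 'a graph" where
  "induced G W = Graph (verts G \<inter> W) {e \<in> edges G. e \<subseteq> W}"

definition degree :: "'a graph \<Rightarrow> 'a \<Rightarrow> nat" where
  "degree G v = card {e \<in> edges G. v \<in> e}"

definition cubic :: "'a graph \<Rightarrow> bool" where
  "cubic G \<longleftrightarrow> simple_graph G \<and> (\<forall>v\<in>verts G. degree G v = 3)"


definition walk :: "'a graph \<Rightarrow> 'a \<Rightarrow> 'a list \<Rightarrow> 'a \<Rightarrow> bool" where
  "walk G u p v \<longleftrightarrow> p \<noteq> [] \<and> hd p = u \<and> last p = v \<and> set p \<subseteq> verts G \<and>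
     successively (\<lambda>x y. {x, y} \<in> edges G) p"

definition connected_graph :: "'a graph \<Rightarrow> bool" where
  "connected_graph G \<longleftrightarrow> verts G \<noteq> {} \<and> (\<forall>u\<in>verts G. \<forall>v\<in>verts G. \<exists>p. walk G u p v)"

definition graph_dist :: "'a graph \<Rightarrow> 'a \<Rightarrow> 'a \<Rightarrow> enat" where
  "graph_dist G u v = (INF p \<in> {p. walk G u p v}. enat (length p - 1))"


text \<open>Cycles are subgraphs, so that they can be counted without multiplicities coming from the
  choice of a starting vertex and of a direction.\<close>

definition cycle_graph :: "'a list \<Rightarrow> 'a graph" where
  "cycle_graph vs = Graph (set vs) {{vs ! i, vs ! (Suc i mod length vs)} | i. i < length vs}"

definition cycles :: "'a graph \<Rightarrow> 'a graph set" where
  "cycles G = {C. subgraph C G \<and> (\<exists>vs. length vs \<ge> 3 \<and> distinct vs \<and> C = cycle_graph vs)}"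

definition cycle_length :: "'a graph \<Rightarrow> nat" where
  "cycle_length C = card (verts C)"

text \<open>The girth of an acyclic graph is \<open>\<infinity>\<close>.\<close>

definition girth :: "'a graph \<Rightarrow> enat" where
  "girth G = (INF C \<in> cycles G. enat (cycle_length C))"

text \<open>Truncated subtraction: \<open>k - cycle_length C\<close> is \<open>max (k - |C|) 0\<close>.\<close>

definition cycle_deficit :: "nat \<Rightarrow> 'a graph \<Rightarrow> nat" where
  "cycle_deficit k C = k - cycle_length C"

definition deficit :: "nat \<Rightarrow> 'a graph \<Rightarrow> nat" where
  "deficit k G = Max {(\<Sum>C\<in>\<C>. cycle_deficit k C) | \<C>.
     \<C> \<subseteq> cycles G \<and> pairwise (\<lambda>C D. verts C \<inter> verts D = {}) \<C>}"


definition relabel :: "('a \<Rightarrow> 'b) \<Rightarrow> 'a graph \<Rightarrow> 'b graph" where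
  "relabel f G = Graph (f ` verts G) ((`) f ` edges G)"

definition graph_iso :: "('a \<Rightarrow> 'b) \<Rightarrow> 'a graph \<Rightarrow> 'b graph \<Rightarrow> bool" where
  "graph_iso f G H \<longleftrightarrow> bij_betw f (verts G) (verts H) \<and> (`) f ` edges G = edges H"

definition isomorphic :: "'a graph \<Rightarrow> 'b graph \<Rightarrow> bool" where
  "isomorphic G H \<longleftrightarrow> (\<exists>f. graph_iso f G H)"

definition automorphisms :: "'a graph \<Rightarrow> ('a \<Rightarrow> 'a) set" where
  "automorphisms G = {f. graph_iso f G G}"

definition canonical_labelling :: "('a graph \<Rightarrow> 'a \<Rightarrow> nat) \<Rightarrow> bool" where
  "canonical_labelling lab \<longleftrightarrow>
     (\<forall>G. simple_graph G \<longrightarrow> bij_betw (lab G) (verts G) {0..<card (verts G)}) \<and>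
     (\<forall>G H. simple_graph G \<and> simple_graph H \<and> isomorphic G H \<longrightarrow>
        relabel (lab G) G = relabel (lab H) H)"


definition edge_quadruples :: "'a graph \<Rightarrow> 'a set set set set" where
  "edge_quadruples G = {{{e1, e2}, {e3, e4}} | e1 e2 e3 e4.
     {e1, e2, e3, e4} \<subseteq> edges G \<and> distinct [e1, e2, e3, e4]}"

definition equivalent_quadruples :: "'a graph \<Rightarrow> 'a set set set \<Rightarrow> 'a set set set \<Rightarrow> bool" where
  "equivalent_quadruples G Q Q' \<longleftrightarrow> (\<exists>f\<in>automorphisms G. (`) ((`) f) ` Q = Q')"

text \<open>Vertices of an expanded graph: \<open>Old v\<close> is a vertex of the original graph, \<open>Sub e\<close> is the
  vertex subdividing the edge \<open>e\<close>, and \<open>Hub p\<close> is the new vertex adjacent to the vertices that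
  subdivide the edges in the pair \<open>p\<close>. For the quadruple \<open>{{e1, e2}, {e3, e4}}\<close> the two hubs are
  the vertices \<open>a\<close> and \<open>b\<close>.\<close>

datatype 'a xvertex = Old 'a | Sub "'a set" | Hub "'a set set"

definition inserted_center :: "'a set set set \<Rightarrow> 'a xvertex set" where
  "inserted_center Q = Hub ` Q"

definition inserted_H :: "'a set set set \<Rightarrow> 'a xvertex graph" where
  "inserted_H Q = Graph (Hub ` Q \<union> Sub ` \<Union>Q)
     (insert (inserted_center Q) {{Hub p, Sub e} | p e. p \<in> Q \<and> e \<in> p})"

definition H_insert :: "'a graph \<Rightarrow> 'a set set set \<Rightarrow> 'a xvertex graph" where
  "H_insert G Q = Graph (Old ` verts G \<union> verts (inserted_H Q))
     ((`) Old ` (edges G - \<Union>Q) \<union> {{Old x, Sub e} | x e. e \<in> \<Union>Q \<and> x \<in> e} \<union>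
      edges (inserted_H Q))"

definition eligible :: "nat \<Rightarrow> 'a graph \<Rightarrow> 'a set set set \<Rightarrow> bool" where
  "eligible k G Q \<longleftrightarrow> Q \<in> edge_quadruples G \<and> girth (H_insert G Q) \<ge> enat k"


definition H_graph :: "'a graph \<Rightarrow> 'a set \<Rightarrow> bool" where
  "H_graph T c \<longleftrightarrow> simple_graph T \<and> connected_graph T \<and> cycles T = {} \<and> card (verts T) = 6 \<and>
     c \<in> edges T \<and> (\<forall>v\<in>c. degree T v = 3)"

definition endvertices :: "'a graph \<Rightarrow> 'a set" where
  "endvertices T = {v \<in> verts T. degree T v = 1}"

definition good_edge :: "'a graph \<Rightarrow> 'a set \<Rightarrow> bool" where
  "good_edge G e \<longleftrightarrow> e \<in> edges G \<and> connected_graph (induced G (verts G - e))"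

text \<open>\<open>T\<close> is a reducible H of \<open>G\<close> with central edge \<open>c\<close>.\<close>

definition reducible_H :: "'a graph \<Rightarrow> 'a graph \<Rightarrow> 'a set \<Rightarrow> bool" where
  "reducible_H G T c \<longleftrightarrow> H_graph T c \<and> subgraph T G \<and> good_edge G c \<and>
     (\<forall>C\<in>cycles G. cycle_length C \<ge> 3 + card (verts C \<inter> endvertices T))"


definition edge_neighbours :: "'a graph \<Rightarrow> 'a set \<Rightarrow> 'a set" where
  "edge_neighbours G c = {v \<in> verts G - c. \<exists>w\<in>c. {v, w} \<in> edges G}"

definition cycles_of_length :: "nat \<Rightarrow> 'a graph \<Rightarrow> 'a graph set" where
  "cycles_of_length l G = {C \<in> cycles G. cycle_length C = l}"

definition num_within :: "nat \<Rightarrow> 'a graph \<Rightarrow> 'a set \<Rightarrow> nat" where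
  "num_within r G c = card {v \<in> verts G. \<exists>w\<in>c. graph_dist G w v \<le> enat r}"

definition edge_orbit :: "'a graph \<Rightarrow> 'a set \<Rightarrow> 'a set set" where
  "edge_orbit G c = {f ` c | f. f \<in> automorphisms G}"

text \<open>The minimum over the orbit and the comparison of tuples below use the lexicographic order on
  products.\<close>

definition orbit_label :: "('a \<Rightarrow> nat) \<Rightarrow> 'a graph \<Rightarrow> 'a set \<Rightarrow> nat \<times> nat" where
  "orbit_label l G c = Min ((\<lambda>e. (Min (l ` e), Max (l ` e))) ` edge_orbit G c)"

definition H_tuple :: "('a graph \<Rightarrow> 'a \<Rightarrow> nat) \<Rightarrow> 'a graph \<Rightarrow> 'a set \<Rightarrow>
    nat \<times> nat \<times> nat \<times> nat \<times> nat \<times> nat \<times> nat" where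
  "H_tuple lab G c =
    (card {C \<in> cycles_of_length 6 G. c \<in> edges C},
     card {v \<in> edge_neighbours G c. \<exists>C\<in>cycles_of_length 6 G. v \<in> verts C \<and> c \<notin> edges C},
     card {C \<in> cycles_of_length 7 G. c \<in> edges C},
     num_within 3 G c,
     num_within 4 G c,
     fst (orbit_label (lab G) G c),
     snd (orbit_label (lab G) G c))"

definition minimal_reducible_H ::
    "('a graph \<Rightarrow> 'a \<Rightarrow> nat) \<Rightarrow> 'a graph \<Rightarrow> 'a graph \<Rightarrow> 'a set \<Rightarrow> bool" where
  "minimal_reducible_H lab G T c \<longleftrightarrow> reducible_H G T c \<and>
     (\<forall>T' c'. reducible_H G T' c' \<longrightarrow> H_tuple lab G c \<le> H_tuple lab G c')"


definition parent_class :: "nat \<Rightarrow> int \<Rightarrow> 'a graph \<Rightarrow> bool" where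
  "parent_class k n G \<longleftrightarrow> connected_graph G \<and> cubic G \<and> int (card (verts G)) = n - 6 \<and>
     deficit k G \<le> 4 \<and> girth G \<ge> enat (if k \<in> {5, 6} then k - 2 else k - 1)"

definition target_class :: "nat \<Rightarrow> int \<Rightarrow> 'a graph \<Rightarrow> bool" where
  "target_class k n G \<longleftrightarrow> connected_graph G \<and> cubic G \<and> int (card (verts G)) = n \<and>
     girth G \<ge> enat k"

text \<open>The runs \<open>(G, Q)\<close> of the insertion step whose result is accepted, where \<open>L\<close> is the collection
  of given graphs and \<open>R G\<close> is the set of edge-quadruples of \<open>G\<close> to which the insertion is
  applied. Keeping the pairs rather than the resulting graphs counts results with multiplicity.\<close>

definition accepted ::
    "('a xvertex graph \<Rightarrow> 'a xvertex \<Rightarrow> nat) \<Rightarrow> int \<Rightarrow> 'a graph set \<Rightarrow>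
     ('a graph \<Rightarrow> 'a set set set set) \<Rightarrow> ('a graph \<times> 'a set set set) set" where
  "accepted lab n L R = {(G, Q). G \<in> L \<and> Q \<in> R G \<and>
     int (card (verts (H_insert G Q))) = n \<and>
     minimal_reducible_H lab (H_insert G Q) (inserted_H Q) (inserted_center Q)}"

end

theory Submission
  imports Defs
begin

text \<open>
  In a connected cubic graph choose an edge \<open>e\<close> and a connected set \<open>K\<close>
  avoiding it with \<open>|K|\<close> maximal: were there further vertices, they would contain an
  edge whose ends could be removed instead, leaving \<open>K \<union> e\<close> connected. So good
  edges exist, and for girth at least 5 the H around a good edge is reducible, since its
  endvertices are independent. Hence every target graph has a reducible H of minimal tuple.

  Reducing it gives a connected cubic graph. A cycle of that graph that uses \<open>i\<close> of the four
  new edges lifts to a cycle that is longer by \<open>i\<close>; for \<open>i \<ge> 2\<close> each of the two arcs between two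
  new edges also closes up to a cycle through the central edge or one of its ends, so the cycle has
  length at least \<open>2k - 8\<close>. This bounds the girth, and summing over disjoint cycles bounds the
  deficit by the number 4 of new edges. So the reduced graph is isomorphic to a given graph, and each
  target graph is accepted at least once.

  Two accepted runs with isomorphic results have centres of equal tuple, hence in the same orbit, so
  that some isomorphism maps one centre to the other. It descends to an isomorphism of the given
  graphs that respects the quadruples, and the runs coincide.
\<close>

subsection \<open>Graphs and connectivity\<close>

text \<open>Acceptance is decided from the expanded graph alone, without reference to the run that
  made it. Two facts make this sound. All seven components of the tuple are isomorphism invariants,
  so isomorphic results have the same least tuple; and equal last components force equal orbits, so
  a least tuple singles out one reduction up to automorphism. Undoing that reduction recovers the
  given graph up to isomorphism and the quadruple up to equivalence, which is precisely the freedom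
  that the choice of representatives leaves.

  Goodness of the centre keeps connectivity intact in both directions: the expanded graph minus its
  centre is the reduced graph with its four new edges subdivided. Girth at least 5 makes the
  reduction well defined, by excluding the triangles and 4-cycles around the centre that would merge
  or double new edges.

  The vertices of the expanded graph are named by the edges and pairs that they come from. An
  isomorphism of the original graphs therefore acts on the names, and comparing expanded graphs
  becomes a case distinction on the kind of a vertex.\<close>

lemma simple_edgeD:
  assumes "simple_graph G" "{x, y} \<in> edges G"
  shows "x \<noteq> y" "x \<in> verts G" "y \<in> verts G"
  using assms by (auto simp: simple_graph_def card_insert_if split: if_splits)

lemma simple_edgeE:
  assumes "simple_graph G" "e \<in> edges G"
  obtains x y where "e = {x, y}" "x \<noteq> y" "x \<in> verts G" "y \<in> verts G"
  using assms unfolding simple_graph_def by (metis card_2_iff insert_subset)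

lemma simple_edge_subset: "simple_graph G \<Longrightarrow> e \<in> edges G \<Longrightarrow> e \<subseteq> verts G"
  by (auto simp: simple_graph_def)

definition nbrs :: "'a graph \<Rightarrow> 'a \<Rightarrow> 'a set" where
  "nbrs G v = {u. {v, u} \<in> edges G}"

lemma nbrs_sym: "u \<in> nbrs G v \<longleftrightarrow> v \<in> nbrs G u"
  by (simp add: nbrs_def insert_commute)

lemma finite_nbrs: "simple_graph G \<Longrightarrow> finite (nbrs G v)"
  by (rule finite_subset[of _ "verts G"]) (auto simp: nbrs_def simple_graph_def)

lemma degree_eq_card_nbrs:
  assumes "simple_graph G"
  shows "degree G v = card (nbrs G v)"
proof -
  have "{e \<in> edges G. v \<in> e} = (\<lambda>u. {v, u}) ` nbrs G v"
  proof (intro equalityI subsetI)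
    fix e assume e: "e \<in> {e \<in> edges G. v \<in> e}"
    then obtain x y where "e = {x, y}" by (auto elim: simple_edgeE[OF assms])
    with e have "e = {v, x} \<or> e = {v, y}" by auto
    with e show "e \<in> (\<lambda>u. {v, u}) ` nbrs G v" by (auto simp: nbrs_def)
  qed (auto simp: nbrs_def)
  moreover have "inj_on (\<lambda>u. {v, u}) (nbrs G v)"
    by (auto simp: inj_on_def doubleton_eq_iff)
  ultimately show ?thesis by (simp add: degree_def card_image)
qed

lemma cubic_card_nbrs: "cubic G \<Longrightarrow> v \<in> verts G \<Longrightarrow> card (nbrs G v) = 3"
  using degree_eq_card_nbrs[of G v] by (simp add: cubic_def)

lemma cubic_simple: "cubic G \<Longrightarrow> simple_graph G"
  by (simp add: cubic_def)

lemma simple_induced: "simple_graph G \<Longrightarrow> simple_graph (induced G W)"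
  by (auto simp: simple_graph_def induced_def)

lemma walk_closed:
  assumes "walk G u p v" "u \<in> A" "\<And>x y. x \<in> A \<Longrightarrow> {x, y} \<in> edges G \<Longrightarrow> y \<in> A"
  shows "v \<in> A"
proof -
  have "successively (\<lambda>x y. {x, y} \<in> edges G) p \<Longrightarrow> p \<noteq> [] \<Longrightarrow> hd p \<in> A \<Longrightarrow> last p \<in> A" for p
    by (induction p rule: induct_list012) (use assms(3) in auto)
  with assms(1,2) show ?thesis by (auto simp: walk_def)
qed

text \<open>A walk cannot leave a set closed under adjacency, and the vertices reachable from
  \<open>u\<close> form such a set. In this form connectivity passes between graphs on different
  vertex sets by restricting or enlarging closed sets, without building walks.\<close>

lemma connected_graph_iff:
  assumes "simple_graph G"
  shows "connected_graph G \<longleftrightarrow> verts G \<noteq> {} \<and>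
    (\<forall>A. A \<subseteq> verts G \<and> A \<noteq> {} \<and> (\<forall>x\<in>A. \<forall>y. {x, y} \<in> edges G \<longrightarrow> y \<in> A) \<longrightarrow> A = verts G)"
    (is "_ \<longleftrightarrow> _ \<and> ?cl")
proof (intro iffI conjI)
  assume con: "connected_graph G"
  then show "verts G \<noteq> {}" by (simp add: connected_graph_def)
  show ?cl
  proof (intro allI impI)
    fix A assume A: "A \<subseteq> verts G \<and> A \<noteq> {} \<and> (\<forall>x\<in>A. \<forall>y. {x, y} \<in> edges G \<longrightarrow> y \<in> A)"
    then obtain u where u: "u \<in> A" "u \<in> verts G" by auto
    have "v \<in> A" if v: "v \<in> verts G" for v
    proof -
      obtain p where "walk G u p v" using con u v by (auto simp: connected_graph_def)
      then show ?thesis by (rule walk_closed) (use A u in auto)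
    qed
    with A show "A = verts G" by auto
  qed
next
  assume *: "verts G \<noteq> {} \<and> ?cl"
  show "connected_graph G"
    unfolding connected_graph_def
  proof (intro conjI ballI)
    show "verts G \<noteq> {}" using * by simp
    fix u v assume u: "u \<in> verts G" and v: "v \<in> verts G"
    let ?A = "{v. \<exists>p. walk G u p v}"
    have "?A = verts G"
    proof (rule *[THEN conjunct2, rule_format], intro conjI ballI allI impI)
      show "?A \<subseteq> verts G" by (auto simp: walk_def)
      have "walk G u [u] u" using u by (simp add: walk_def)
      then show "?A \<noteq> {}" by blast
      fix x y assume x: "x \<in> ?A" and e: "{x, y} \<in> edges G"
      then obtain p where p: "walk G u p x" by blast
      have "walk G u (p @ [y]) y"
        using p e simple_edgeD[OF assms e]
        by (auto simp: walk_def successively_append_iff)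
      then show "y \<in> ?A" by blast
    qed
    with v show "\<exists>p. walk G u p v" by blast
  qed
qed

lemma connected_induced_insert:
  assumes G: "simple_graph G" and con: "connected_graph (induced G K)"
    and K: "K \<subseteq> verts G" and x: "x \<in> verts G" and y: "y \<in> K" "{x, y} \<in> edges G"
  shows "connected_graph (induced G (insert x K))"
proof (subst connected_graph_iff[OF simple_induced[OF G]], intro conjI allI impI)
  show "verts (induced G (insert x K)) \<noteq> {}" using x by (auto simp: induced_def)
  fix A assume A: "A \<subseteq> verts (induced G (insert x K)) \<and> A \<noteq> {} \<and>
     (\<forall>a\<in>A. \<forall>b. {a, b} \<in> edges (induced G (insert x K)) \<longrightarrow> b \<in> A)"
  have yx: "{y, x} \<in> edges G" using y by (simp add: insert_commute)
  \<comment> \<open>A closed set consisting of \<open>x\<close> alone would miss the neighbour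
    \<open>y\<close>. Once \<open>A\<close> meets \<open>K\<close>, its trace is closed in the
    connected graph on \<open>K\<close> and hence is all of \<open>K\<close>.\<close>
  have "A \<inter> K \<noteq> {}"
  proof
    assume E: "A \<inter> K = {}"
    with A have "x \<in> A" by (auto simp: induced_def)
    then have "y \<in> A" using A y K by (auto simp: induced_def)
    with y E show False by auto
  qed
  then have "A \<inter> K = verts (induced G K)"
    using con[unfolded connected_graph_iff[OF simple_induced[OF G]], THEN conjunct2, rule_format, of "A \<inter> K"] A
    by (auto simp: induced_def)
  then have "K \<subseteq> A" using K by (auto simp: induced_def)
  moreover then have "x \<in> A" using A yx y(1) by (auto simp: induced_def)
  ultimately show "A = verts (induced G (insert x K))" using A by (auto simp: induced_def)
qed

subsection \<open>Existence of a good edge\<close>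

lemma good_edge_exists:
  assumes cub: "cubic G" and con: "connected_graph G"
  shows "\<exists>e. good_edge G e"
proof -
  note G = cubic_simple[OF cub]
  define P where "P = (\<lambda>(e, K). e \<in> edges G \<and> K \<subseteq> verts G - e \<and> connected_graph (induced G K))"
  have fin: "finite (verts G)" using G by (simp add: simple_graph_def)
  obtain v where v: "v \<in> verts G" using con by (auto simp: connected_graph_def)
  then have n3: "card (nbrs G v) = 3" by (rule cubic_card_nbrs[OF cub])
  then obtain a b where ab: "a \<in> nbrs G v" "b \<in> nbrs G v" "a \<noteq> b"
    using card_le_Suc0_iff_eq[OF finite_nbrs[OF G], of v] by auto
  have bv: "b \<in> verts G" "b \<noteq> v" "{v, a} \<in> edges G"
    using ab simple_edgeD[OF G, of v b] by (auto simp: nbrs_def)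
  \<comment> \<open>A starting pair for the maximisation: the edge from \<open>v\<close> to one
    neighbour, and a second neighbour as a one-vertex connected set.\<close>
  have "connected_graph (induced G {b})"
    by (subst connected_graph_iff[OF simple_induced[OF G]]) (use bv in \<open>auto simp: induced_def\<close>)
  then have "P ({v, a}, {b})" using bv ab by (auto simp: P_def)
  moreover have "card (snd z) < Suc (card (verts G))" if "P z" for z
  proof -
    have "snd z \<subseteq> verts G" using that by (cases z) (auto simp: P_def)
    then show ?thesis using card_mono[OF fin] by (simp add: less_Suc_eq_le)
  qed
  ultimately obtain z where z: "P z" and zmax: "\<And>w. P w \<Longrightarrow> card (snd w) \<le> card (snd z)"
    using ex_has_greatest_nat[of P _ "\<lambda>z. card (snd z)" "Suc (card (verts G))"] by (metis less_imp_le_nat)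
  obtain e K where zeq: "z = (e, K)" by force
  have e: "e \<in> edges G" and K: "K \<subseteq> verts G - e" and cK: "connected_graph (induced G K)"
    using z by (auto simp: P_def zeq)
  have finK: "finite K" using K fin by (metis finite_Diff finite_subset)
  have Kmax: "card K' \<le> card K"
    if "e' \<in> edges G" "K' \<subseteq> verts G - e'" "connected_graph (induced G K')" for e' K'
    using zmax[of "(e', K')"] that by (simp add: P_def zeq)
  obtain x y where xy: "e = {x, y}" "x \<noteq> y" "x \<in> verts G" "y \<in> verts G"
    using simple_edgeE[OF G e] .
  have "K = verts G - e"
  proof (rule ccontr)
    assume "K \<noteq> verts G - e"
    then obtain z where zv: "z \<in> verts G" "z \<notin> e" "z \<notin> K" using K by auto
    \<comment> \<open>A remaining vertex with a neighbour in \<open>K\<close> could be added to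
      \<open>K\<close>, so by maximality the rest has no edges to \<open>K\<close>.\<close>
    have nadj: "u \<notin> nbrs G w" if "w \<in> verts G - e - K" "u \<in> K" for w u
    proof
      assume "u \<in> nbrs G w"
      then have "connected_graph (induced G (insert w K))"
        using connected_induced_insert[OF G cK, of w u] that K by (auto simp: nbrs_def)
      from Kmax[OF e _ this] show False using that K finK by auto
    qed
    \<comment> \<open>Degree 3 enters here: at most two neighbours of \<open>z\<close> lie on
      \<open>e\<close>, so a third one lies in the rest, and \<open>{z, w}\<close> is the edge to
      remove instead of \<open>e\<close>.\<close>
    have "\<not> nbrs G z \<subseteq> {x, y}"
    proof
      assume "nbrs G z \<subseteq> {x, y}"
      from card_mono[OF _ this] show False
        using cubic_card_nbrs[OF cub zv(1)] xy(2) by simp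
    qed
    then obtain w where w: "w \<in> nbrs G z" "w \<notin> e" using xy by auto
    then have zw: "{z, w} \<in> edges G" "w \<in> verts G"
      using simple_edgeD[OF G, of z w] by (auto simp: nbrs_def)
    have wK: "w \<notin> K" using nadj[of z w] zv w by auto
    have "verts (induced G K) \<noteq> {}" using cK by (auto simp: connected_graph_def)
    then have "K \<noteq> {}" by (auto simp: induced_def)
    moreover have "K \<noteq> verts G" using zv by auto
    \<comment> \<open>Some edge leaves the proper non-empty set \<open>K\<close>; by
      \<open>nadj\<close> it can only lead to an end of \<open>e\<close>. So both ends of
      \<open>e\<close> can be attached to \<open>K\<close>.\<close>
    ultimately have "\<not> (\<forall>x\<in>K. \<forall>y. {x, y} \<in> edges G \<longrightarrow> y \<in> K)"
      using con[unfolded connected_graph_iff[OF G], THEN conjunct2, rule_format, of K] K by auto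
    then obtain u t where ut: "u \<in> K" "{u, t} \<in> edges G" "t \<notin> K"
      by blast
    then have tv: "t \<in> verts G" using simple_edgeD[OF G] by blast
    have te: "t \<in> e"
      using nadj[of t u] ut tv by (auto simp: nbrs_def insert_commute)
    then obtain s where s: "e = {s, t}" "s \<noteq> t" "s \<in> verts G" using xy by fastforce
    have 1: "connected_graph (induced G (insert t K))"
      using connected_induced_insert[OF G cK _ tv, of u] K ut by (auto simp: insert_commute)
    have "connected_graph (induced G (insert s (insert t K)))"
      using connected_induced_insert[OF G 1, of s t] K tv s e by auto
    from Kmax[OF zw(1) _ this] have "card (insert s (insert t K)) \<le> card K"
      using K s tv zv w wK by auto
    then show False using s ut K finK by (auto simp: card_insert_if split: if_splits)
  qed
  with e cK show ?thesis by (auto simp: good_edge_def)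
qed

subsection \<open>Isomorphisms\<close>

lemma graph_iso_relabel_iff: "graph_iso f G H \<longleftrightarrow> inj_on f (verts G) \<and> relabel f G = H"
  by (cases G; cases H) (auto simp: graph_iso_def relabel_def bij_betw_def)

lemma graph_iso_relabel: "inj_on f (verts G) \<Longrightarrow> graph_iso f G (relabel f G)"
  by (simp add: graph_iso_relabel_iff)

lemma graph_iso_inj: "graph_iso f G H \<Longrightarrow> inj_on f (verts G)"
  by (simp add: graph_iso_def bij_betw_def)

lemma graph_iso_verts: "graph_iso f G H \<Longrightarrow> verts H = f ` verts G"
  by (auto simp: graph_iso_def bij_betw_def)

lemma graph_iso_edges: "graph_iso f G H \<Longrightarrow> edges H = (`) f ` edges G"
  by (simp add: graph_iso_def)

lemma graph_iso_id: "graph_iso id G G"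
  by (simp add: graph_iso_def)

lemma graph_iso_comp:
  assumes "graph_iso f G H" "graph_iso g H K"
  shows "graph_iso (g \<circ> f) G K"
proof -
  have "(`) (g \<circ> f) = (`) g \<circ> (`) f" by (auto simp: fun_eq_iff)
  then have "(`) (g \<circ> f) ` edges G = (`) g ` (`) f ` edges G" by (simp only: image_comp)
  also have "\<dots> = edges K" using assms by (simp add: graph_iso_def)
  finally show ?thesis
    using assms bij_betw_trans by (auto simp: graph_iso_def)
qed

text \<open>Simplicity puts every edge inside the vertex set, the only place where \<open>f\<close>
  and its inverse are controlled.\<close>

lemma graph_iso_inverse:
  assumes "graph_iso f G H" "simple_graph G"
  obtains g where "graph_iso g H G" "\<And>x. x \<in> verts G \<Longrightarrow> g (f x) = x"
    "\<And>y. y \<in> verts H \<Longrightarrow> f (g y) = y"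
proof
  let ?g = "the_inv_into (verts G) f"
  have inj: "inj_on f (verts G)" and V: "verts H = f ` verts G"
    using assms(1) by (rule graph_iso_inj, rule graph_iso_verts)
  show gf: "?g (f x) = x" if "x \<in> verts G" for x
    using the_inv_into_f_f[OF inj that] .
  show "f (?g y) = y" if "y \<in> verts H" for y
    using f_the_inv_into_f[OF inj] that V by auto
  have "?g ` f ` e = e" if "e \<subseteq> verts G" for e
    using that gf by force
  then have "(`) ?g ` edges H = edges G"
    using assms by (auto simp: graph_iso_edges[OF assms(1)] image_iff simple_graph_def)
  then show "graph_iso ?g H G"
    using assms(1) by (auto simp: graph_iso_def intro: bij_betw_the_inv_into)
qed

lemma isomorphic_sym: "simple_graph G \<Longrightarrow> isomorphic G H \<Longrightarrow> isomorphic H G"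
  unfolding isomorphic_def by (metis graph_iso_inverse)

lemma isomorphic_trans: "isomorphic G H \<Longrightarrow> isomorphic H K \<Longrightarrow> isomorphic G K"
  unfolding isomorphic_def by (metis graph_iso_comp)

context
  fixes f :: "'a \<Rightarrow> 'b" and G :: "'a graph" and H :: "'b graph"
  assumes iso: "graph_iso f G H" and G: "simple_graph G"
begin

lemma iso_image_eq: "A \<subseteq> verts G \<Longrightarrow> B \<subseteq> verts G \<Longrightarrow> f ` A = f ` B \<longleftrightarrow> A = B"
  using graph_iso_inj[OF iso] by (rule inj_on_image_eq_iff)

lemma iso_image_mem: "x \<in> verts G \<Longrightarrow> B \<subseteq> verts G \<Longrightarrow> f x \<in> f ` B \<longleftrightarrow> x \<in> B"
  using graph_iso_inj[OF iso] by (rule inj_on_image_mem_iff)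

lemma iso_edge: "e \<subseteq> verts G \<Longrightarrow> f ` e \<in> edges H \<longleftrightarrow> e \<in> edges G"
  using iso_image_eq G by (auto simp: graph_iso_edges[OF iso] simple_graph_def)

lemma iso_adj: "x \<in> verts G \<Longrightarrow> y \<in> verts G \<Longrightarrow> {f x, f y} \<in> edges H \<longleftrightarrow> {x, y} \<in> edges G"
  using iso_edge[of "{x, y}"] by simp

lemma iso_card: "A \<subseteq> verts G \<Longrightarrow> card (f ` A) = card A"
  using graph_iso_inj[OF iso] by (metis card_image inj_on_subset)

lemma iso_card_verts: "card (verts H) = card (verts G)"
  using iso_card[of "verts G"] graph_iso_verts[OF iso] by simp

lemma iso_simple: "simple_graph H"
  using G iso_card by (auto simp: simple_graph_def graph_iso_edges[OF iso] graph_iso_verts[OF iso])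

lemma iso_degree: "v \<in> verts G \<Longrightarrow> degree H (f v) = degree G v"
proof -
  assume v: "v \<in> verts G"
  have "{e \<in> edges H. f v \<in> e} = (`) f ` {e \<in> edges G. v \<in> e}"
    using iso_image_mem[OF v] G by (auto simp: graph_iso_edges[OF iso] simple_graph_def)
  moreover have "inj_on ((`) f) {e \<in> edges G. v \<in> e}"
    using iso_image_eq G by (intro inj_onI) (auto simp: simple_graph_def)
  ultimately show ?thesis by (simp add: degree_def card_image)
qed

lemma iso_cubic: "cubic G \<Longrightarrow> cubic H"
  using iso_simple iso_degree by (auto simp: cubic_def graph_iso_verts[OF iso])

lemma iso_walk: "walk G u p v \<Longrightarrow> walk H (f u) (map f p) (f v)"
proof -
  assume w: "walk G u p v"
  then have "successively (\<lambda>x y. {f x, f y} \<in> edges H) p"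
    unfolding walk_def by (metis (mono_tags, lifting) iso_adj subsetD successively_mono)
  with w show ?thesis
    by (auto simp: walk_def hd_map last_map graph_iso_verts[OF iso] successively_map)
qed

lemma iso_connected: "connected_graph G \<Longrightarrow> connected_graph H"
  unfolding connected_graph_def graph_iso_verts[OF iso] using iso_walk by blast

lemma iso_subgraph:
  assumes "subgraph T G"
  shows "graph_iso f T (relabel f T)" "subgraph (relabel f T) H"
proof -
  show "graph_iso f T (relabel f T)"
    using assms graph_iso_inj[OF iso]
    by (auto simp: graph_iso_relabel_iff subgraph_def intro: inj_on_subset)
  show "subgraph (relabel f T) H"
    using assms by (auto simp: subgraph_def relabel_def graph_iso_verts[OF iso] graph_iso_edges[OF iso])
qed

end

lemma iso_good_edge:
  assumes iso: "graph_iso f G H" and G: "simple_graph G" and "good_edge G e"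
  shows "good_edge H (f ` e)"
proof -
  have e: "e \<in> edges G" "connected_graph (induced G (verts G - e))"
    using assms(3) by (auto simp: good_edge_def)
  then have eV: "e \<subseteq> verts G" using G by (auto simp: simple_graph_def)
  have *: "f ` (verts G - e) = verts H - f ` e"
    using eV inj_on_image_set_diff[OF graph_iso_inj[OF iso], of "verts G" e]
    by (simp add: graph_iso_verts[OF iso])
  have sub: "(f ` d \<subseteq> f ` (verts G - e)) = (d \<subseteq> verts G - e)" if "d \<in> edges G" for d
  proof -
    have "d \<subseteq> verts G" using that G by (auto simp: simple_graph_def)
    then show ?thesis
      unfolding image_subset_iff using inj_on_image_mem_iff[OF graph_iso_inj[OF iso], of _ "verts G - e"]
      by blast
  qed
  have "subgraph (induced G (verts G - e)) G" by (auto simp: subgraph_def induced_def)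
  from iso_subgraph(1)[OF iso G this]
  have "graph_iso f (induced G (verts G - e)) (relabel f (induced G (verts G - e)))" .
  moreover have "relabel f (induced G (verts G - e)) = induced H (verts H - f ` e)"
    unfolding induced_def relabel_def *[symmetric]
    using sub by (auto simp: graph_iso_edges[OF iso] graph_iso_verts[OF iso])
  ultimately have "graph_iso f (induced G (verts G - e)) (induced H (verts H - f ` e))" by simp
  from iso_connected[OF this simple_induced[OF G] e(2)] e(1) show ?thesis
    by (auto simp: good_edge_def graph_iso_edges[OF iso])
qed

subsection \<open>Cycles as vertex lists\<close>

text \<open>Indices modulo the length are awkward to split. A cycle is handled as a path in list
  form together with one separate closing edge \<open>{last vs, hd vs}\<close>.\<close>

fun path_edges :: "'a list \<Rightarrow> 'a set set" where
  "path_edges (x # y # r) = insert {x, y} (path_edges (y # r))"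
| "path_edges _ = {}"

lemma path_edges_nth: "path_edges vs = {{vs ! i, vs ! Suc i} | i. Suc i < length vs}"
proof (induction vs rule: path_edges.induct)
  case (1 x y r)
  have "{{(x # y # r) ! i, (x # y # r) ! Suc i} | i. Suc i < length (x # y # r)}
      = insert {x, y} {{(y # r) ! i, (y # r) ! Suc i} | i. Suc i < length (y # r)}" (is "?L = insert _ ?R")
  proof (intro equalityI subsetI)
    fix e assume "e \<in> ?L"
    then obtain i where i: "e = {(x # y # r) ! i, (x # y # r) ! Suc i}" "Suc i < length (x # y # r)"
      by blast
    then show "e \<in> insert {x, y} ?R" by (cases i) auto
  next
    fix e assume "e \<in> insert {x, y} ?R"
    then consider "e = {x, y}" | i where "e = {(y # r) ! i, (y # r) ! Suc i}" "Suc i < length (y # r)"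
      by blast
    then show "e \<in> ?L"
    proof cases
      case 1 then show ?thesis by (intro CollectI exI[of _ 0]) simp
    next
      case 2 then show ?thesis by (intro CollectI exI[of _ "Suc i"]) simp
    qed
  qed
  with 1 show ?case by simp
qed auto

lemma path_edges_append:
  "p \<noteq> [] \<Longrightarrow> q \<noteq> [] \<Longrightarrow> path_edges (p @ q) = insert {last p, hd q} (path_edges p \<union> path_edges q)"
proof (induction p rule: path_edges.induct)
  case ("2_2" v) then show ?case by (cases q) auto
qed auto

lemma path_edges_subset: "e \<in> path_edges p \<Longrightarrow> e \<subseteq> set p"
  by (induction p rule: path_edges.induct) auto

lemma finite_path_edges: "finite (path_edges p)"
  by (induction p rule: path_edges.induct) auto

lemma path_edges_split:
  "e \<in> path_edges vs \<Longrightarrow> \<exists>p q. vs = p @ q \<and> p \<noteq> [] \<and> q \<noteq> [] \<and> e = {last p, hd q}"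
proof (induction vs rule: path_edges.induct)
  case (1 x y r)
  show ?case
  proof (cases "e = {x, y}")
    case True then show ?thesis by (intro exI[of _ "[x]"] exI[of _ "y # r"]) simp
  next
    case False
    then obtain p q where "y # r = p @ q" "p \<noteq> []" "q \<noteq> []" "e = {last p, hd q}" using 1 by auto
    then show ?thesis by (intro exI[of _ "x # p"] exI[of _ q]) simp
  qed
qed auto

lemma verts_cycle_graph [simp]: "verts (cycle_graph vs) = set vs"
  by (simp add: cycle_graph_def)

lemma edges_cycle_graph:
  assumes "vs \<noteq> []"
  shows "edges (cycle_graph vs) = insert {last vs, hd vs} (path_edges vs)"
proof -
  have "{{vs ! i, vs ! (Suc i mod length vs)} | i. i < length vs} =
      insert {last vs, hd vs} {{vs ! i, vs ! Suc i} | i. Suc i < length vs}" (is "?L = insert _ ?R")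
  proof (intro equalityI subsetI)
    fix e assume "e \<in> ?L"
    then obtain i where i: "e = {vs ! i, vs ! (Suc i mod length vs)}" "i < length vs" by blast
    show "e \<in> insert {last vs, hd vs} ?R"
    proof (cases "Suc i < length vs")
      case True with i show ?thesis by auto
    next
      case False
      then have "Suc i = length vs" using i by simp
      then show ?thesis using i assms by (auto simp: last_conv_nth hd_conv_nth simp flip: \<open>Suc i = _\<close>)
    qed
  next
    fix e assume "e \<in> insert {last vs, hd vs} ?R"
    then consider "e = {last vs, hd vs}" | i where "e = {vs ! i, vs ! Suc i}" "Suc i < length vs"
      by blast
    then show "e \<in> ?L"
    proof cases
      case 1 then show ?thesis using assms
        by (intro CollectI exI[of _ "length vs - 1"]) (simp add: last_conv_nth hd_conv_nth)
    next
      case 2 then show ?thesis by (intro CollectI exI[of _ i]) simp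
    qed
  qed
  then show ?thesis by (simp add: cycle_graph_def path_edges_nth)
qed

text \<open>Under rotation the closing edge and the edge joining \<open>p\<close> to
  \<open>q\<close> trade places. This allows any edge of a cycle to be made the closing one.\<close>

lemma cycle_graph_swap:
  assumes "p \<noteq> []" "q \<noteq> []"
  shows "cycle_graph (q @ p) = cycle_graph (p @ q)"
proof -
  have "edges (cycle_graph (q @ p)) = edges (cycle_graph (p @ q))"
    using assms by (subst (1 2) edges_cycle_graph) (auto simp: path_edges_append)
  moreover have "verts (cycle_graph (q @ p)) = verts (cycle_graph (p @ q))" by auto
  ultimately show ?thesis by (simp add: graph.expand)
qed

lemma in_cyclesE:
  assumes "C \<in> cycles G"
  obtains vs where "C = cycle_graph vs" "length vs \<ge> 3" "distinct vs"
    "path_edges vs \<subseteq> edges G" "{last vs, hd vs} \<in> edges G" "set vs \<subseteq> verts G"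
proof -
  from assms obtain vs where vs: "C = cycle_graph vs" "length vs \<ge> 3" "distinct vs" "subgraph C G"
    by (auto simp: cycles_def)
  then have "vs \<noteq> []" by auto
  with vs show ?thesis using that[of vs] by (auto simp: subgraph_def edges_cycle_graph)
qed

lemma cycle_graph_in_cycles:
  assumes "simple_graph G" "length vs \<ge> 3" "distinct vs"
    "path_edges vs \<subseteq> edges G" "{last vs, hd vs} \<in> edges G"
  shows "cycle_graph vs \<in> cycles G"
proof -
  have ne: "vs \<noteq> []" using assms(2) by auto
  \<comment> \<open>Every vertex is covered by an edge: the head by the closing edge, all others by
    path edges. In a simple graph the vertices of the list are therefore vertices of
    \<open>G\<close>.\<close>
  have "set p \<subseteq> insert (hd p) (\<Union>(path_edges p))" if "p \<noteq> []" for p :: "'a list"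
    using that by (induction p rule: path_edges.induct) auto
  from this[OF ne] have "set vs \<subseteq> verts G"
    using assms(1,4,5) unfolding simple_graph_def by blast
  then have "subgraph (cycle_graph vs) G"
    using assms ne by (auto simp: subgraph_def edges_cycle_graph)
  with assms show ?thesis by (auto simp: cycles_def)
qed

lemma cycle_length_cycle_graph: "distinct vs \<Longrightarrow> cycle_length (cycle_graph vs) = length vs"
  by (simp add: cycle_length_def distinct_card)

lemma girth_ge_iff: "enat k \<le> girth G \<longleftrightarrow> (\<forall>C\<in>cycles G. k \<le> cycle_length C)"
  by (simp add: girth_def le_INF_iff)

lemma girth_length:
  assumes "enat k \<le> girth G" "simple_graph G" "length vs \<ge> 3" "distinct vs"
    "path_edges vs \<subseteq> edges G" "{last vs, hd vs} \<in> edges G"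
  shows "k \<le> length vs"
  using assms cycle_graph_in_cycles[OF assms(2-)] cycle_length_cycle_graph[OF assms(4)]
  by (metis girth_ge_iff)

text \<open>Rotate the list so that \<open>v\<close> comes first. Its neighbours are then the second
  and the last entry, which differ because there are at least three entries.\<close>

lemma cycle_two_neighbours:
  assumes "length vs \<ge> 3" "distinct vs" "v \<in> set vs"
  obtains u w where "u \<noteq> w" "u \<noteq> v" "w \<noteq> v" "u \<in> set vs" "w \<in> set vs"
    "{v, u} \<in> edges (cycle_graph vs)" "{v, w} \<in> edges (cycle_graph vs)"
proof -
  obtain p q where pq: "vs = p @ v # q" using assms(3) by (meson split_list)
  obtain a b r where r: "q @ p = a # r @ [b]"
  proof -
    have "length (q @ p) \<ge> 2" using assms(1) pq by simp
    then obtain a s where s: "q @ p = a # s" "s \<noteq> []"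
      by (cases "q @ p") (force simp: Suc_le_eq)+
    then show ?thesis using that[of a "butlast s" "last s"] by simp
  qed
  have eq: "cycle_graph (v # q @ p) = cycle_graph vs"
    using pq cycle_graph_swap[of p "v # q"] by (cases "p = []") auto
  have "{v, a} \<in> edges (cycle_graph vs)" "{v, b} \<in> edges (cycle_graph vs)"
    using r by (auto simp: edges_cycle_graph insert_commute simp flip: eq)
  moreover have "set (q @ p) \<subseteq> set vs" "distinct (v # q @ p)" using assms(2) pq by auto
  then have "a \<noteq> b" "a \<noteq> v" "b \<noteq> v" "a \<in> set vs" "b \<in> set vs" unfolding r by auto
  ultimately show ?thesis using that[of a b] by auto
qed

text \<open>The successor along the cycle maps an independent set injectively into its complement.\<close>

lemma cycle_independent:
  assumes "C \<in> cycles G" "\<And>x y. x \<in> I \<Longrightarrow> y \<in> I \<Longrightarrow> {x, y} \<notin> edges G"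
  shows "2 * card (verts C \<inter> I) \<le> cycle_length C"
proof -
  obtain vs where vs: "C = cycle_graph vs" "length vs \<ge> 3" "distinct vs" "subgraph C G"
    using assms(1) by (auto simp: cycles_def)
  let ?n = "length vs"
  define J where "J = {j. j < ?n \<and> vs ! j \<in> I}"
  let ?s = "\<lambda>j. Suc j mod ?n"
  have finJ: "finite J" by (simp add: J_def)
  have inj: "inj_on ?s {..<?n}"
  proof (rule inj_onI)
    fix i j assume "i \<in> {..<?n}" "j \<in> {..<?n}" "?s i = ?s j"
    then show "i = j" by (auto simp: mod_Suc split: if_splits)
  qed
  have "?s ` J \<subseteq> {..<?n} - J"
  proof
    fix m assume "m \<in> ?s ` J"
    then obtain j where j: "m = ?s j" "j < ?n" "vs ! j \<in> I" by (auto simp: J_def)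
    have "{vs ! j, vs ! m} \<in> edges C" using j vs(1) by (auto simp: cycle_graph_def)
    then have "{vs ! j, vs ! m} \<in> edges G" using vs(4) by (auto simp: subgraph_def)
    with assms(2) j(3) have "vs ! m \<notin> I" by blast
    moreover have "m < ?n" using j vs(2) by (auto intro!: mod_less_divisor)
    ultimately show "m \<in> {..<?n} - J" by (auto simp: J_def)
  qed
  then have "card (?s ` J) \<le> card ({..<?n} - J)" by (intro card_mono) auto
  moreover have "card (?s ` J) = card J"
    by (intro card_image inj_on_subset[OF inj]) (auto simp: J_def)
  moreover have "card ({..<?n} - J) = ?n - card J"
    by (subst card_Diff_subset) (auto simp: J_def)
  moreover have "(!) vs ` J = verts C \<inter> I"
    by (auto simp: J_def vs(1) in_set_conv_nth)
  then have "card (verts C \<inter> I) \<le> card J" using card_image_le[OF finJ, of "(!) vs"] by simp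
  moreover have "J \<subseteq> {..<?n}" by (auto simp: J_def)
  then have "card J \<le> ?n" using card_mono[of "{..<?n}" J] by simp
  moreover have "cycle_length C = ?n" using cycle_length_cycle_graph[OF vs(3)] vs(1) by simp
  ultimately show ?thesis by linarith
qed

subsection \<open>Isomorphism invariance of the tuple\<close>

lemma relabel_cycle_graph: "relabel f (cycle_graph vs) = cycle_graph (map f vs)"
proof -
  have *: "cycle_graph us = Graph (set us) ((\<lambda>i. {us ! i, us ! (Suc i mod length us)}) ` {..<length us})"
    for us :: "'c list"
    by (auto simp: cycle_graph_def)
  have "Suc i mod length vs < length vs" if "i < length vs" for i
    using that by (intro mod_less_divisor) auto
  then show ?thesis
    by (simp add: * relabel_def image_image cong: image_cong_simp)
qed

lemma iso_cycle:
  assumes iso: "graph_iso f G H" and G: "simple_graph G" and C: "C \<in> cycles G"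
  shows "relabel f C \<in> cycles H"
proof -
  obtain vs where vs: "C = cycle_graph vs" "length vs \<ge> 3" "distinct vs" "subgraph C G"
    using C by (auto simp: cycles_def)
  have "inj_on f (set vs)"
    using graph_iso_inj[OF iso] vs by (auto simp: subgraph_def intro: inj_on_subset)
  then have "relabel f C = cycle_graph (map f vs)" "distinct (map f vs)" "length (map f vs) \<ge> 3"
    using vs by (auto simp: relabel_cycle_graph distinct_map)
  then show ?thesis
    using iso_subgraph(2)[OF iso G vs(4)] unfolding cycles_def by blast
qed

lemma cycles_subset:
  assumes "C \<in> cycles G"
  shows "verts C \<subseteq> verts G" "edges C \<subseteq> edges G"
  using assms by (auto simp: cycles_def subgraph_def)

lemma relabel_inverse:
  assumes "simple_graph G" "\<And>x. x \<in> verts G \<Longrightarrow> g (f x) = x" "C \<in> cycles G"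
  shows "relabel g (relabel f C) = C"
proof -
  have id: "g ` f ` e = e" if "e \<subseteq> verts G" for e
    using that assms(2) by force
  have "e \<subseteq> verts G" if "e \<in> edges C" for e
    using that cycles_subset[OF assms(3)] assms(1) by (auto simp: simple_graph_def)
  then have "(\<lambda>e. g ` f ` e) ` edges C = (\<lambda>e. e) ` edges C"
    using id by (intro image_cong) auto
  then show ?thesis
    using id cycles_subset[OF assms(3)] by (cases C) (simp add: relabel_def image_image)
qed

lemma iso_bij_cycles:
  assumes iso: "graph_iso f G H" and G: "simple_graph G"
  shows "bij_betw (relabel f) (cycles G) (cycles H)"
proof -
  obtain g where g: "graph_iso g H G" "\<And>x. x \<in> verts G \<Longrightarrow> g (f x) = x"
    "\<And>y. y \<in> verts H \<Longrightarrow> f (g y) = y"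
    using graph_iso_inverse[OF iso G] by blast
  have H: "simple_graph H" using iso_simple[OF iso G] .
  show ?thesis
    by (rule bij_betw_byWitness[where f' = "relabel g"])
      (use relabel_inverse[OF G, of g f] relabel_inverse[OF H, of f g] g(2,3) iso_cycle[OF iso G] iso_cycle[OF g(1) H] in auto)
qed

lemma iso_cycle_length:
  assumes "graph_iso f G H" "simple_graph G" "C \<in> cycles G"
  shows "cycle_length (relabel f C) = cycle_length C"
  using iso_card[OF assms(1,2) cycles_subset(1)[OF assms(3)]]
  by (simp add: cycle_length_def relabel_def)

lemma iso_girth:
  assumes "graph_iso f G H" "simple_graph G"
  shows "girth H = girth G"
proof -
  have "cycles H = relabel f ` cycles G"
    using iso_bij_cycles[OF assms] by (simp add: bij_betw_def)
  then show ?thesis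
    by (simp add: girth_def image_image iso_cycle_length[OF assms] cong: image_cong)
qed

lemma card_filter_bij:
  assumes "bij_betw h A B" "\<And>x. x \<in> A \<Longrightarrow> P x \<longleftrightarrow> P' (h x)"
  shows "card {y \<in> B. P' y} = card {x \<in> A. P x}"
proof -
  have "{y \<in> B. P' y} = h ` {x \<in> A. P x}" using assms by (auto simp: bij_betw_def)
  moreover have "inj_on h {x \<in> A. P x}" using assms(1) by (auto simp: bij_betw_def intro: inj_on_subset)
  ultimately show ?thesis by (simp add: card_image)
qed

lemma iso_dist:
  assumes iso: "graph_iso f G H" and G: "simple_graph G" and uv: "u \<in> verts G" "v \<in> verts G"
  shows "graph_dist H (f u) (f v) = graph_dist G u v"
proof (rule antisym)
  \<comment> \<open>Proved for arbitrary vertex types, since it is applied to \<open>f\<close> and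
    then to the inverse of \<open>f\<close>.\<close>
  have le: "graph_dist H' (f' u) (f' v) \<le> graph_dist G' u v"
    if "graph_iso f' G' H'" "simple_graph G'" for f' :: "'c \<Rightarrow> 'd" and G' H' u v
    unfolding graph_dist_def
  proof (rule INF_mono)
    fix p assume "p \<in> {p. walk G' u p v}"
    then show "\<exists>q\<in>{q. walk H' (f' u) q (f' v)}. enat (length q - 1) \<le> enat (length p - 1)"
      using iso_walk[OF that, of u p v] by (intro bexI[of _ "map f' p"]) auto
  qed
  show "graph_dist H (f u) (f v) \<le> graph_dist G u v" using le[OF iso G] .
  obtain g where g: "graph_iso g H G" "\<And>x. x \<in> verts G \<Longrightarrow> g (f x) = x"
    using graph_iso_inverse[OF iso G] by blast
  show "graph_dist G u v \<le> graph_dist H (f u) (f v)"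
    using le[OF g(1) iso_simple[OF iso G], of "f u" "f v"] g(2) uv by simp
qed

lemma iso_num_within:
  assumes iso: "graph_iso f G H" and G: "simple_graph G" and c: "c \<subseteq> verts G"
  shows "num_within r H (f ` c) = num_within r G c"
  unfolding num_within_def
  by (rule card_filter_bij[of f]) (use iso iso_dist[OF iso G] c in \<open>auto simp: graph_iso_def subset_iff\<close>)

lemma iso_cycle_edge:
  assumes iso: "graph_iso f G H" and G: "simple_graph G" and C: "C \<in> cycles G" and c: "c \<subseteq> verts G"
  shows "f ` c \<in> edges (relabel f C) \<longleftrightarrow> c \<in> edges C"
proof -
  have "f ` c = f ` e \<longleftrightarrow> c = e" if "e \<in> edges C" for e
    using iso_image_eq[OF iso G c simple_edge_subset[OF G]] that cycles_subset(2)[OF C] by auto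
  then show ?thesis by (auto simp: relabel_def)
qed

lemma iso_card_cycles_edge:
  assumes iso: "graph_iso f G H" and G: "simple_graph G" and c: "c \<subseteq> verts G"
  shows "card {C \<in> cycles_of_length l H. f ` c \<in> edges C} = card {C \<in> cycles_of_length l G. c \<in> edges C}"
proof -
  have "card {C \<in> cycles H. cycle_length C = l \<and> f ` c \<in> edges C}
      = card {C \<in> cycles G. cycle_length C = l \<and> c \<in> edges C}"
    by (rule card_filter_bij[OF iso_bij_cycles[OF iso G]])
      (simp add: iso_cycle_length[OF iso G] iso_cycle_edge[OF iso G _ c])
  then show ?thesis by (simp add: cycles_of_length_def conj_assoc)
qed

lemma iso_edge_neighbours:
  assumes iso: "graph_iso f G H" and G: "simple_graph G" and c: "c \<subseteq> verts G" and v: "v \<in> verts G"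
  shows "f v \<in> edge_neighbours H (f ` c) \<longleftrightarrow> v \<in> edge_neighbours G c"
  using iso_image_mem[OF iso G v c] iso_adj[OF iso G v] v c
  by (auto simp: edge_neighbours_def graph_iso_verts[OF iso])

lemma iso_card_neighbours_on_cycles:
  assumes iso: "graph_iso f G H" and G: "simple_graph G" and c: "c \<subseteq> verts G"
  shows "card {v \<in> edge_neighbours H (f ` c). \<exists>C\<in>cycles_of_length l H. v \<in> verts C \<and> f ` c \<notin> edges C}
    = card {v \<in> edge_neighbours G c. \<exists>C\<in>cycles_of_length l G. v \<in> verts C \<and> c \<notin> edges C}"
proof -
  have cyc: "cycles H = relabel f ` cycles G"
    using iso_bij_cycles[OF iso G] by (simp add: bij_betw_def)
  have *: "(\<exists>C\<in>cycles_of_length l H. f v \<in> verts C \<and> f ` c \<notin> edges C) \<longleftrightarrow>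
      (\<exists>C\<in>cycles_of_length l G. v \<in> verts C \<and> c \<notin> edges C)" if v: "v \<in> verts G" for v
  proof -
    have "f v \<in> verts (relabel f C) \<longleftrightarrow> v \<in> verts C" if "C \<in> cycles G" for C
      using iso_image_mem[OF iso G v cycles_subset(1)[OF that]] by (simp add: relabel_def)
    then show ?thesis
      using iso_cycle_length[OF iso G] iso_cycle_edge[OF iso G _ c]
      unfolding cycles_of_length_def cyc by auto
  qed
  have "card {v \<in> verts H. v \<in> edge_neighbours H (f ` c) \<and>
        (\<exists>C\<in>cycles_of_length l H. v \<in> verts C \<and> f ` c \<notin> edges C)}
    = card {v \<in> verts G. v \<in> edge_neighbours G c \<and>
        (\<exists>C\<in>cycles_of_length l G. v \<in> verts C \<and> c \<notin> edges C)}"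
    by (rule card_filter_bij[of f])
      (use iso in \<open>auto simp: graph_iso_def * iso_edge_neighbours[OF iso G c]\<close>)
  moreover have "{v \<in> edge_neighbours H d. P v} = {v \<in> verts H. v \<in> edge_neighbours H d \<and> P v}" for d P
    by (auto simp: edge_neighbours_def)
  moreover have "{v \<in> edge_neighbours G d. P v} = {v \<in> verts G. v \<in> edge_neighbours G d \<and> P v}" for d P
    by (auto simp: edge_neighbours_def)
  ultimately show ?thesis by simp
qed

section \<open>Canonical labels and orbits of edges\<close>

lemma canonical_labelling_iso:
  fixes lab :: "'a graph \<Rightarrow> 'a \<Rightarrow> nat"
  assumes lab: "canonical_labelling lab" and iso: "graph_iso f G H" and G: "simple_graph G"
  obtains g where "graph_iso g G H" "\<And>x. x \<in> verts G \<Longrightarrow> lab H (g x) = lab G x"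
proof -
  have H: "simple_graph H" using iso_simple[OF iso G] .
  \<comment> \<open>\<open>f\<close> itself need not respect labels. The relabelled copies of
    \<open>G\<close> and \<open>H\<close> coincide, so going to the copy along \<open>lab G\<close>
    and back along \<open>lab H\<close> gives an isomorphism that does.\<close>
  have "relabel (lab G) G = relabel (lab H) H"
    using lab G H iso unfolding canonical_labelling_def isomorphic_def by blast
  moreover have "graph_iso (lab K) K (relabel (lab K) K)" if "simple_graph K" for K
    using lab that by (intro graph_iso_relabel) (auto simp: canonical_labelling_def bij_betw_def)
  ultimately have lG: "graph_iso (lab G) G (relabel (lab H) H)"
    and lH: "graph_iso (lab H) H (relabel (lab H) H)"
    using G H by metis+
  obtain m where m: "graph_iso m (relabel (lab H) H) H"
      "\<And>y. y \<in> verts (relabel (lab H) H) \<Longrightarrow> lab H (m y) = y"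
    using graph_iso_inverse[OF lH H] by metis
  show ?thesis
  proof
    show "graph_iso (m \<circ> lab G) G H" using graph_iso_comp[OF lG m(1)] .
    show "lab H ((m \<circ> lab G) x) = lab G x" if "x \<in> verts G" for x
      using m(2) graph_iso_verts[OF lG] that by auto
  qed
qed

lemma edge_orbitI: "graph_iso h G G \<Longrightarrow> h ` c \<in> edge_orbit G c"
  by (auto simp: edge_orbit_def automorphisms_def)

text \<open>For an automorphism \<open>h\<close> of \<open>H\<close>, applying \<open>f\<close>,
  then \<open>h\<close>, then the inverse of \<open>g\<close> is an automorphism of
  \<open>G\<close>.\<close>

lemma edge_orbit_conjugate:
  assumes "graph_iso f G H" "graph_iso g G H" "simple_graph G" "c \<subseteq> verts G"
  shows "edge_orbit H (f ` c) \<subseteq> (`) g ` edge_orbit G c"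
proof
  fix e assume "e \<in> edge_orbit H (f ` c)"
  then obtain h where h: "graph_iso h H H" "e = h ` f ` c"
    by (auto simp: edge_orbit_def automorphisms_def)
  obtain g' where g': "graph_iso g' H G" "\<And>y. y \<in> verts H \<Longrightarrow> g (g' y) = y"
    using graph_iso_inverse[OF assms(2,3)] by metis
  have "h ` f ` c \<subseteq> verts H"
    using assms(4) graph_iso_verts[OF assms(1)] graph_iso_verts[OF h(1)] by blast
  then have id: "g ` g' ` h ` f ` c = h ` f ` c" using g'(2) by force
  have "graph_iso (g' \<circ> h \<circ> f) G G"
    using graph_iso_comp[OF assms(1) graph_iso_comp[OF h(1) g'(1)]] by (simp add: comp_assoc)
  moreover have "g' ` h ` f ` c = (g' \<circ> h \<circ> f) ` c" by (simp add: image_image)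
  ultimately have "g' ` h ` f ` c \<in> edge_orbit G c"
    using edge_orbitI[of "g' \<circ> h \<circ> f" G c] by (simp only:)
  then show "e \<in> (`) g ` edge_orbit G c" using id h(2) by (metis image_eqI)
qed

text \<open>Two isomorphisms differ by an automorphism, so the orbit of the image is the same for
  both. Hence a given \<open>f\<close> may be traded for one that preserves labels.\<close>

lemma edge_orbit_iso:
  assumes "graph_iso f G H" "graph_iso g G H" "simple_graph G" "c \<subseteq> verts G"
  shows "edge_orbit H (f ` c) = (`) g ` edge_orbit G c"
proof
  show "edge_orbit H (f ` c) \<subseteq> (`) g ` edge_orbit G c" using edge_orbit_conjugate[OF assms] .
  show "(`) g ` edge_orbit G c \<subseteq> edge_orbit H (f ` c)"
  proof
    fix e assume "e \<in> (`) g ` edge_orbit G c"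
    then obtain h where h: "graph_iso h G G" "e = g ` h ` c"
      by (auto simp: edge_orbit_def automorphisms_def)
    obtain f' where f': "graph_iso f' H G" "\<And>y. y \<in> verts G \<Longrightarrow> f' (f y) = y"
      using graph_iso_inverse[OF assms(1,3)] by metis
    have "f' ` f ` c = c" using f'(2) assms(4) by force
    moreover have "(g \<circ> h \<circ> f') ` f ` c = g ` h ` f' ` f ` c" by (simp add: image_image)
    ultimately have "e = (g \<circ> h \<circ> f') ` f ` c" using h(2) by simp
    moreover have "graph_iso (g \<circ> h \<circ> f') H H"
      using graph_iso_comp[OF f'(1) graph_iso_comp[OF h(1) assms(2)]] by (simp add: comp_assoc)
    ultimately show "e \<in> edge_orbit H (f ` c)"
      using edge_orbitI[of "g \<circ> h \<circ> f'" H "f ` c"] by (simp only:)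
  qed
qed

lemma edge_orbit_subset: "e \<in> edge_orbit G c \<Longrightarrow> c \<subseteq> verts G \<Longrightarrow> e \<subseteq> verts G"
  by (auto simp: edge_orbit_def automorphisms_def dest!: graph_iso_verts)

lemma iso_orbit_label:
  assumes lab: "canonical_labelling lab" and iso: "graph_iso f G H" and G: "simple_graph G"
    and c: "c \<subseteq> verts G"
  shows "orbit_label (lab H) H (f ` c) = orbit_label (lab G) G c"
proof -
  obtain g where g: "graph_iso g G H" "\<And>x. x \<in> verts G \<Longrightarrow> lab H (g x) = lab G x"
    using canonical_labelling_iso[OF lab iso G] by blast
  have "lab H ` g ` e = lab G ` e" if "e \<in> edge_orbit G c" for e
    using edge_orbit_subset[OF that c] g(2) by (force simp: image_image)
  then show ?thesis
    unfolding orbit_label_def edge_orbit_iso[OF iso g(1) G c] by (simp add: image_image cong: image_cong)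
qed

lemma iso_H_tuple:
  assumes "canonical_labelling lab" "graph_iso f G H" "simple_graph G" "c \<subseteq> verts G"
  shows "H_tuple lab H (f ` c) = H_tuple lab G c"
  using iso_orbit_label[OF assms] iso_card_cycles_edge[OF assms(2-)]
    iso_card_neighbours_on_cycles[OF assms(2-)] iso_num_within[OF assms(2-)]
  by (simp add: H_tuple_def)

text \<open>Each minimum is attained at an edge of its orbit. Labels are injective, so equal label
  pairs mean that both are attained at the same edge, and orbits that share an edge
  coincide.\<close>

lemma orbit_label_eq:
  assumes lab: "canonical_labelling lab" and G: "simple_graph G"
    and c: "c \<in> edges G" "c' \<in> edges G"
    and eq: "orbit_label (lab G) G c = orbit_label (lab G) G c'"
  obtains f where "graph_iso f G G" "f ` c = c'"
proof -
  have inj: "inj_on (lab G) (verts G)"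
    using lab G by (auto simp: canonical_labelling_def bij_betw_def)
  let ?m = "\<lambda>e. (Min (lab G ` e), Max (lab G ` e))"
  have witness: "\<exists>h. graph_iso h G G \<and> h ` d \<in> edges G \<and> orbit_label (lab G) G d = ?m (h ` d)"
    if d: "d \<in> edges G" for d
  proof -
    have dV: "d \<subseteq> verts G" using simple_edge_subset[OF G d] .
    have "edge_orbit G d \<subseteq> Pow (verts G)" using edge_orbit_subset[OF _ dV] by blast
    then have "finite (edge_orbit G d)"
      using G by (meson finite_Pow_iff finite_subset simple_graph_def)
    moreover have "d \<in> edge_orbit G d"
      using edge_orbitI[OF graph_iso_id, of d G] by simp
    ultimately have "Min (?m ` edge_orbit G d) \<in> ?m ` edge_orbit G d"
      by (intro Min_in) auto
    then obtain h where "graph_iso h G G" "orbit_label (lab G) G d = ?m (h ` d)"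
      unfolding orbit_label_def by (auto simp: edge_orbit_def automorphisms_def)
    moreover then have "h ` d \<in> edges G" using d by (metis graph_iso_edges imageI)
    ultimately show ?thesis by blast
  qed
  obtain h where h: "graph_iso h G G" "h ` c \<in> edges G" "orbit_label (lab G) G c = ?m (h ` c)"
    using witness[OF c(1)] by metis
  obtain h' where h': "graph_iso h' G G" "h' ` c' \<in> edges G" "orbit_label (lab G) G c' = ?m (h' ` c')"
    using witness[OF c(2)] by metis
  \<comment> \<open>An edge has just two ends, so least and greatest label already give all its
    labels.\<close>
  have img: "lab G ` d = {Min (lab G ` d), Max (lab G ` d)}" if "d \<in> edges G" for d
  proof -
    obtain x y where "d = {x, y}" using simple_edgeE[OF G \<open>d \<in> edges G\<close>] by blast
    then show ?thesis by (auto simp: min_def max_def)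
  qed
  have "lab G ` h ` c = lab G ` h' ` c'" using img[OF h(2)] img[OF h'(2)] h(3) h'(3) eq by simp
  then have eq': "h ` c = h' ` c'"
    by (rule iffD1[OF inj_on_image_eq_iff[OF inj simple_edge_subset[OF G h(2)] simple_edge_subset[OF G h'(2)]]])
  obtain g where g: "graph_iso g G G" "\<And>x. x \<in> verts G \<Longrightarrow> g (h' x) = x"
    using graph_iso_inverse[OF h'(1) G] by metis
  have "(g \<circ> h) ` c = g ` h ` c" by (simp add: image_image)
  also have "\<dots> = g ` h' ` c'" using eq' by simp
  also have "\<dots> = c'" using g(2) simple_edge_subset[OF G c(2)] by force
  finally show ?thesis by (rule that[OF graph_iso_comp[OF h(1) g(1)]])
qed

lemma iso_reducible_H:
  assumes iso: "graph_iso f G H" and G: "simple_graph G" and red: "reducible_H G T c"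
  shows "reducible_H H (relabel f T) (f ` c)"
proof -
  have T: "H_graph T c" "subgraph T G" "good_edge G c"
    and cyc: "\<And>C. C \<in> cycles G \<Longrightarrow> 3 + card (verts C \<inter> endvertices T) \<le> cycle_length C"
    using red by (auto simp: reducible_H_def)
  have sT: "simple_graph T" and cT: "c \<in> edges T" using T(1) by (auto simp: H_graph_def)
  note isoT = iso_subgraph(1)[OF iso G T(2)]
  have VT: "verts T \<subseteq> verts G" using T(2) by (simp add: subgraph_def)
  have "cycles (relabel f T) = {}"
    using T(1) iso_bij_cycles[OF isoT sT] by (auto simp: H_graph_def bij_betw_def)
  moreover have "c \<subseteq> verts T" using cT sT by (rule simple_edge_subset[rotated])
  ultimately have "H_graph (relabel f T) (f ` c)"
    using T(1) iso_simple[OF isoT sT] iso_connected[OF isoT sT] iso_card_verts[OF isoT sT]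
      iso_degree[OF isoT sT] graph_iso_edges[OF isoT]
    by (auto simp: H_graph_def)
  moreover have "3 + card (verts D \<inter> endvertices (relabel f T)) \<le> cycle_length D" if "D \<in> cycles H" for D
  proof -
    have "D \<in> relabel f ` cycles G"
      using that iso_bij_cycles[OF iso G] by (simp add: bij_betw_def)
    then obtain C where C: "C \<in> cycles G" "D = relabel f C" by blast
    have ev: "endvertices (relabel f T) = f ` endvertices T"
      using iso_degree[OF isoT sT] graph_iso_verts[OF isoT] by (auto simp: endvertices_def)
    have eV: "endvertices T \<subseteq> verts G" using VT by (auto simp: endvertices_def)
    have "f ` (verts C \<inter> endvertices T) = f ` verts C \<inter> f ` endvertices T"
      using inj_on_image_Int[OF graph_iso_inj[OF iso] cycles_subset(1)[OF C(1)] eV] .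
    then have "verts D \<inter> endvertices (relabel f T) = f ` (verts C \<inter> endvertices T)"
      using ev C(2) by (simp add: relabel_def)
    then have "card (verts D \<inter> endvertices (relabel f T)) = card (verts C \<inter> endvertices T)"
      using iso_card[OF iso G, of "verts C \<inter> endvertices T"] eV by auto
    then show ?thesis using cyc[OF C(1)] iso_cycle_length[OF iso G C(1)] C(2) by simp
  qed
  ultimately show ?thesis
    using iso_subgraph(2)[OF iso G T(2)] iso_good_edge[OF iso G T(3)] by (simp add: reducible_H_def)
qed

subsection \<open>The insertion operation\<close>

lemma quadrupleE:
  assumes "Q \<in> edge_quadruples G"
  obtains e1 e2 e3 e4 where "Q = {{e1, e2}, {e3, e4}}" "distinct [e1, e2, e3, e4]"
    "{e1, e2, e3, e4} \<subseteq> edges G"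
  using assms by (auto simp: edge_quadruples_def)

text \<open>Stated for four different elements of any type, so that the case analysis of doubletons
  does not see that the elements are sets themselves. The last item says when two hubs are
  adjacent.\<close>

lemma pair_of_pairs:
  fixes Q :: "'c set set"
  assumes "Q = {{a, b}, {c, d}}" "distinct [a, b, c, d]"
  shows "card (\<Union>Q) = 4" "card Q = 2" "finite (\<Union>Q)" "finite Q"
    and "p \<in> Q \<Longrightarrow> card p = 2" "p \<in> Q \<Longrightarrow> q \<in> Q \<Longrightarrow> x \<in> p \<Longrightarrow> x \<in> q \<Longrightarrow> p = q"
    and "p \<in> Q \<Longrightarrow> Q = {p, q} \<longleftrightarrow> q \<in> Q - {p}"
  using assms by (auto simp: doubleton_eq_iff)

lemma quadruple_Union_subset: "Q \<in> edge_quadruples G \<Longrightarrow> \<Union>Q \<subseteq> edges G"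
  by (erule quadrupleE) simp

lemma quadruple_card_Union: "Q \<in> edge_quadruples G \<Longrightarrow> card (\<Union>Q) = 4"
  by (erule quadrupleE) (rule pair_of_pairs)

lemma quadruple_finite_Union: "Q \<in> edge_quadruples G \<Longrightarrow> finite (\<Union>Q)"
  by (erule quadrupleE) (rule pair_of_pairs)

lemma quadruple_finite: "Q \<in> edge_quadruples G \<Longrightarrow> finite Q"
  by (erule quadrupleE) (rule pair_of_pairs)

lemma quadruple_card: "Q \<in> edge_quadruples G \<Longrightarrow> card Q = 2"
  by (erule quadrupleE) (rule pair_of_pairs)

lemma quadruple_pair_card: "Q \<in> edge_quadruples G \<Longrightarrow> p \<in> Q \<Longrightarrow> card p = 2"
  by (erule quadrupleE) (rule pair_of_pairs(5))

lemma quadruple_disjoint: "Q \<in> edge_quadruples G \<Longrightarrow> p \<in> Q \<Longrightarrow> q \<in> Q \<Longrightarrow> e \<in> p \<Longrightarrow> e \<in> q \<Longrightarrow> p = q"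
  by (erule quadrupleE) (rule pair_of_pairs(6))

lemma quadruple_eq_iff: "Q \<in> edge_quadruples G \<Longrightarrow> p \<in> Q \<Longrightarrow> Q = {p, q} \<longleftrightarrow> q \<in> Q - {p}"
  by (erule quadrupleE) (rule pair_of_pairs(7))

lemma Old_image_eq_doubleton: "Old ` e = {Old x, Old y} \<longleftrightarrow> e = {x, y}"
  using inj_image_eq_iff[of Old e "{x, y}"] by (simp add: inj_def)

lemma Hub_image_eq_doubleton: "Hub ` e = {Hub x, Hub y} \<longleftrightarrow> e = {x, y}"
  using inj_image_eq_iff[of Hub e "{x, y}"] by (simp add: inj_def)

lemma H_insert_Old_Old: "{Old x, Old y} \<in> edges (H_insert G Q) \<longleftrightarrow> {x, y} \<in> edges G - \<Union>Q"
proof -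
  have 1: "{Old x, Old y} \<in> (`) Old ` A \<longleftrightarrow> {x, y} \<in> A" for A
    by (auto simp: image_iff Old_image_eq_doubleton eq_commute[of "{Old x, Old y}"])
  have 2: "{Old x, Old y} \<notin> {{Old x, Sub e} | x e. e \<in> \<Union>Q \<and> x \<in> e}"
    by (auto simp: doubleton_eq_iff)
  have 3: "{Old x, Old y} \<notin> edges (inserted_H Q)"
    by (auto simp: inserted_H_def inserted_center_def doubleton_eq_iff)
  show ?thesis by (simp only: H_insert_def graph.sel Un_iff 1 2 3 simp_thms)
qed

lemma H_insert_Old_Sub: "{Old x, Sub e} \<in> edges (H_insert G Q) \<longleftrightarrow> e \<in> \<Union>Q \<and> x \<in> e"
  by (auto simp: H_insert_def inserted_H_def inserted_center_def doubleton_eq_iff)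

lemma H_insert_Old_Hub: "{Old x, Hub p} \<notin> edges (H_insert G Q)"
  by (auto simp: H_insert_def inserted_H_def inserted_center_def doubleton_eq_iff)

lemma H_insert_Sub_Sub: "{Sub e, Sub d} \<notin> edges (H_insert G Q)"
  by (auto simp: H_insert_def inserted_H_def inserted_center_def doubleton_eq_iff)

lemma H_insert_Sub_Hub: "{Sub e, Hub p} \<in> edges (H_insert G Q) \<longleftrightarrow> p \<in> Q \<and> e \<in> p"
  by (auto simp: H_insert_def inserted_H_def inserted_center_def doubleton_eq_iff)

lemma H_insert_Hub_Hub: "{Hub p, Hub q} \<in> edges (H_insert G Q) \<longleftrightarrow> Q = {p, q}"
proof -
  have "{Hub p, Hub q} = Hub ` Q \<longleftrightarrow> {p, q} = Q"
    using Hub_image_eq_doubleton[of Q p q] by auto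
  then show ?thesis
    by (auto simp: H_insert_def inserted_H_def inserted_center_def doubleton_eq_iff)
qed

lemmas H_insert_adj = H_insert_Old_Old H_insert_Old_Sub H_insert_Old_Hub H_insert_Sub_Sub
  H_insert_Sub_Hub H_insert_Hub_Hub

text \<open>The simplifier does not reorder doubletons, so the adjacencies between vertices of
  different kinds are kept in both orders.\<close>

lemmas H_insert_adj' = H_insert_Old_Sub[unfolded insert_commute[of "Old _"]]
  H_insert_Old_Hub[unfolded insert_commute[of "Old _"]]
  H_insert_Sub_Hub[unfolded insert_commute[of "Sub _"]]

lemma verts_inserted_H: "verts (inserted_H Q) = Hub ` Q \<union> Sub ` \<Union>Q"
  by (simp add: inserted_H_def)

lemma verts_H_insert: "verts (H_insert G Q) = Old ` verts G \<union> Hub ` Q \<union> Sub ` \<Union>Q"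
  by (auto simp: H_insert_def verts_inserted_H)

lemma subgraph_inserted_H: "subgraph (inserted_H Q) (H_insert G Q)"
  by (auto simp: subgraph_def H_insert_def)

lemma inserted_H_adj:
  "{Sub e, Sub d} \<notin> edges (inserted_H Q)"
  "{Sub e, Hub p} \<in> edges (inserted_H Q) \<longleftrightarrow> p \<in> Q \<and> e \<in> p"
  "{Hub p, Sub e} \<in> edges (inserted_H Q) \<longleftrightarrow> p \<in> Q \<and> e \<in> p"
  "{Hub p, Hub q} \<in> edges (inserted_H Q) \<longleftrightarrow> Q = {p, q}"
proof -
  have "{Hub p, Hub q} = Hub ` Q \<longleftrightarrow> {p, q} = Q"
    using Hub_image_eq_doubleton[of Q p q] by auto
  then show "{Hub p, Hub q} \<in> edges (inserted_H Q) \<longleftrightarrow> Q = {p, q}"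
    by (auto simp: inserted_H_def inserted_center_def doubleton_eq_iff)
qed (auto simp: inserted_H_def inserted_center_def doubleton_eq_iff)

section \<open>Order and degrees of the expanded graph\<close>

context
  fixes G :: "'a graph" and Q
  assumes G: "simple_graph G" and Q: "Q \<in> edge_quadruples G"
begin

lemma simple_H_insert: "simple_graph (H_insert G Q)"
proof -
  have "card (Old ` e) = card e" for e :: "'a set"
    by (rule card_image) (auto simp: inj_on_def)
  moreover have "card (Hub ` Q) = 2"
    using quadruple_card[OF Q] by (subst card_image) (auto simp: inj_on_def)
  moreover have "x \<in> verts G" if "x \<in> e" "e \<in> edges G" for x e
    using that simple_edge_subset[OF G] by blast
  moreover have "x \<in> verts G" if "x \<in> e" "e \<in> p" "p \<in> Q" for x e p
    using that quadruple_Union_subset[OF Q] simple_edge_subset[OF G] by blast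
  ultimately show ?thesis
    using G quadruple_finite[OF Q] quadruple_finite_Union[OF Q]
    by (auto simp: simple_graph_def H_insert_def inserted_H_def inserted_center_def image_iff)
qed

lemma card_verts_H_insert: "card (verts (H_insert G Q)) = card (verts G) + 6"
proof -
  have fin: "finite (verts G)" "finite Q" "finite (\<Union>Q)"
    using G quadruple_finite[OF Q] quadruple_finite_Union[OF Q]
    by (auto simp: simple_graph_def)
  have "card (Old ` verts G) = card (verts G)" "card (Hub ` Q) = 2" "card (Sub ` \<Union>Q) = 4"
    using quadruple_card[OF Q] quadruple_card_Union[OF Q] by (subst card_image; simp add: inj_on_def)+
  moreover have "card (Old ` verts G \<union> Hub ` Q \<union> Sub ` \<Union>Q)
      = card (Old ` verts G) + card (Hub ` Q) + card (Sub ` \<Union>Q)"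
    by (subst card_Un_disjoint; (subst card_Un_disjoint)?) (use fin in auto)
  ultimately show ?thesis by (simp add: verts_H_insert)
qed

text \<open>A subdivided edge at \<open>x\<close> exchanges one neighbour \<open>Old y\<close> for
  one neighbour \<open>Sub e\<close>. Counting kept and subdivided edges separately gives the old
  degree.\<close>

lemma degree_H_insert_Old: "degree (H_insert G Q) (Old x) = degree G x"
proof -
  let ?Y = "H_insert G Q"
  have "nbrs ?Y (Old x) = Old ` {y. {x, y} \<in> edges G - \<Union>Q} \<union> Sub ` {e \<in> \<Union>Q. x \<in> e}"
  proof (intro set_eqI)
    show "v \<in> nbrs ?Y (Old x) \<longleftrightarrow> v \<in> Old ` {y. {x, y} \<in> edges G - \<Union>Q} \<union> Sub ` {e \<in> \<Union>Q. x \<in> e}" for v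
      by (cases v) (auto simp: nbrs_def H_insert_adj)
  qed
  moreover have "finite {y. {x, y} \<in> edges G - \<Union>Q}"
    by (rule finite_subset[OF _ finite_nbrs[OF G, of x]]) (auto simp: nbrs_def)
  moreover have fin: "finite {e \<in> \<Union>Q. x \<in> e}"
    by (rule finite_subset[OF _ quadruple_finite_Union[OF Q]]) auto
  moreover have "card (Old ` {y. {x, y} \<in> edges G - \<Union>Q}) = card {y. {x, y} \<in> edges G - \<Union>Q}"
     "card (Sub ` {e \<in> \<Union>Q. x \<in> e}) = card {e \<in> \<Union>Q. x \<in> e}"
    by (auto intro!: card_image simp: inj_on_def)
  moreover have "Old ` A \<inter> Sub ` B = {}" for A :: "'a set" and B by auto
  ultimately have 1: "degree ?Y (Old x) = card {y. {x, y} \<in> edges G - \<Union>Q} + card {e \<in> \<Union>Q. x \<in> e}"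
    using card_Un_disjoint[of "Old ` {y. {x, y} \<in> edges G - \<Union>Q}" "Sub ` {e \<in> \<Union>Q. x \<in> e}"]
    by (simp only: degree_eq_card_nbrs[OF simple_H_insert] finite_imageI)
  have "{e \<in> edges G - \<Union>Q. x \<in> e} = (\<lambda>y. {x, y}) ` {y. {x, y} \<in> edges G - \<Union>Q}"
  proof (intro equalityI subsetI)
    fix e assume e: "e \<in> {e \<in> edges G - \<Union>Q. x \<in> e}"
    then obtain u v where "e = {u, v}" by (auto elim: simple_edgeE[OF G])
    with e have "e = {x, u} \<or> e = {x, v}" by auto
    with e show "e \<in> (\<lambda>y. {x, y}) ` {y. {x, y} \<in> edges G - \<Union>Q}" by auto
  qed auto
  then have 2: "card {e \<in> edges G - \<Union>Q. x \<in> e} = card {y. {x, y} \<in> edges G - \<Union>Q}"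
    by (simp only:) (rule card_image, auto simp: inj_on_def doubleton_eq_iff)
  have "{e \<in> edges G. x \<in> e} = {e \<in> edges G - \<Union>Q. x \<in> e} \<union> {e \<in> \<Union>Q. x \<in> e}"
    using quadruple_Union_subset[OF Q] by auto
  moreover have "finite (edges G)"
    using G by (meson PowI finite_Pow_iff finite_subset simple_edge_subset simple_graph_def subsetI)
  ultimately have "degree G x = card {e \<in> edges G - \<Union>Q. x \<in> e} + card {e \<in> \<Union>Q. x \<in> e}"
    unfolding degree_def using fin by (simp only:) (rule card_Un_disjoint, auto)
  with 1 2 show ?thesis by simp
qed

lemma inserted_H_nbrs_Hub:
  assumes "p \<in> Q"
  shows "nbrs (inserted_H Q) (Hub p) = Sub ` p \<union> Hub ` (Q - {p})"
    and "nbrs (H_insert G Q) (Hub p) = Sub ` p \<union> Hub ` (Q - {p})"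
proof -
  have ge: "edges (inserted_H Q) \<subseteq> Pow (Hub ` Q \<union> Sub ` \<Union>Q)"
    by (auto simp: inserted_H_def inserted_center_def)
  show "nbrs (inserted_H Q) (Hub p) = Sub ` p \<union> Hub ` (Q - {p})"
  proof (intro set_eqI)
    show "v \<in> nbrs (inserted_H Q) (Hub p) \<longleftrightarrow> v \<in> Sub ` p \<union> Hub ` (Q - {p})" for v
      using assms quadruple_eq_iff[OF Q assms] ge by (cases v) (auto simp: nbrs_def inserted_H_adj)
  qed
  show "nbrs (H_insert G Q) (Hub p) = Sub ` p \<union> Hub ` (Q - {p})"
  proof (intro set_eqI)
    show "v \<in> nbrs (H_insert G Q) (Hub p) \<longleftrightarrow> v \<in> Sub ` p \<union> Hub ` (Q - {p})" for v
      using assms quadruple_eq_iff[OF Q assms]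
      by (cases v) (auto simp: nbrs_def H_insert_adj H_insert_adj')
  qed
qed

lemma card_Hub_nbrs:
  assumes "p \<in> Q"
  shows "card (Sub ` p \<union> Hub ` (Q - {p})) = 3"
proof -
  have "card p = 2" "card Q = 2" using quadruple_pair_card[OF Q assms] quadruple_card[OF Q] by auto
  then have fin: "finite p" "finite Q" by (auto intro: card_ge_0_finite)
  have "card (Sub ` p) = 2" "card (Hub ` (Q - {p})) = 1"
    using \<open>card p = 2\<close> \<open>card Q = 2\<close> assms fin by (subst card_image; simp add: inj_on_def)+
  then show ?thesis using fin by (subst card_Un_disjoint) auto
qed

lemma Hubs_of_Sub:
  assumes "e \<in> \<Union>Q"
  obtains p where "p \<in> Q" "{p \<in> Q. e \<in> p} = {p}"
  using assms quadruple_disjoint[OF Q] by blast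

lemma degree_H_insert_Hub: "p \<in> Q \<Longrightarrow> degree (H_insert G Q) (Hub p) = 3"
  by (simp add: degree_eq_card_nbrs[OF simple_H_insert] inserted_H_nbrs_Hub card_Hub_nbrs)

lemma degree_H_insert_Sub:
  assumes e: "e \<in> \<Union>Q"
  shows "degree (H_insert G Q) (Sub e) = 3"
proof -
  obtain p where p: "{p \<in> Q. e \<in> p} = {p}" using Hubs_of_Sub[OF e] .
  have "e \<in> edges G" using e quadruple_Union_subset[OF Q] by blast
  then have ce: "card e = 2" using G by (simp add: simple_graph_def)
  have "nbrs (H_insert G Q) (Sub e) = Old ` e \<union> Hub ` {p \<in> Q. e \<in> p}"
  proof (intro set_eqI)
    show "v \<in> nbrs (H_insert G Q) (Sub e) \<longleftrightarrow> v \<in> Old ` e \<union> Hub ` {p \<in> Q. e \<in> p}" for v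
      using e by (cases v) (auto simp: nbrs_def H_insert_adj H_insert_adj')
  qed
  also have "\<dots> = insert (Hub p) (Old ` e)" unfolding p by auto
  also have "card \<dots> = 3"
    using ce by (subst card_insert_disjoint)
      (auto simp: card_image inj_on_def intro: card_ge_0_finite)
  finally show ?thesis by (simp add: degree_eq_card_nbrs[OF simple_H_insert])
qed

text \<open>New vertices have degree 3 by construction and old ones keep their degree. Read from
  left to right this serves the reduction, from right to left the accepted results.\<close>

lemma cubic_H_insert_iff: "cubic (H_insert G Q) \<longleftrightarrow> cubic G"
  using simple_H_insert G degree_H_insert_Old degree_H_insert_Hub degree_H_insert_Sub
  by (simp add: cubic_def verts_H_insert ball_Un)

section \<open>The inserted H as a reducible H\<close>

lemma simple_inserted_H: "simple_graph (inserted_H Q)"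
proof -
  have "finite (verts (inserted_H Q))"
    using simple_H_insert by (auto simp: simple_graph_def verts_H_insert verts_inserted_H)
  moreover have "e \<subseteq> verts (inserted_H Q)" if "e \<in> edges (inserted_H Q)" for e
    using that by (auto simp: inserted_H_def inserted_center_def)
  ultimately show ?thesis
    using subgraph_inserted_H[of Q G] simple_H_insert unfolding simple_graph_def subgraph_def by blast
qed

lemma degree_inserted_H_Hub: "p \<in> Q \<Longrightarrow> degree (inserted_H Q) (Hub p) = 3"
  by (simp add: degree_eq_card_nbrs[OF simple_inserted_H] inserted_H_nbrs_Hub card_Hub_nbrs)

lemma degree_inserted_H_Sub:
  assumes e: "e \<in> \<Union>Q"
  shows "degree (inserted_H Q) (Sub e) = 1"
proof -
  obtain p where p: "{p \<in> Q. e \<in> p} = {p}" using Hubs_of_Sub[OF e] .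
  have "nbrs (inserted_H Q) (Sub e) = Hub ` {p \<in> Q. e \<in> p}"
  proof (intro set_eqI)
    have "{Sub e, Old x} \<notin> edges (inserted_H Q)" for x
      by (auto simp: inserted_H_def inserted_center_def doubleton_eq_iff)
    then show "v \<in> nbrs (inserted_H Q) (Sub e) \<longleftrightarrow> v \<in> Hub ` {p \<in> Q. e \<in> p}" for v
      by (cases v) (auto simp: nbrs_def inserted_H_adj)
  qed
  then show ?thesis by (simp add: degree_eq_card_nbrs[OF simple_inserted_H] p)
qed

lemma endvertices_inserted_H: "endvertices (inserted_H Q) = Sub ` \<Union>Q"
  using degree_inserted_H_Hub degree_inserted_H_Sub by (auto simp: endvertices_def verts_inserted_H)

lemma connected_inserted_H: "connected_graph (inserted_H Q)"
proof (subst connected_graph_iff[OF simple_inserted_H], intro conjI allI impI)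
  obtain p q where pq: "Q = {p, q}" using quadruple_card[OF Q] by (meson card_2_iff)
  then show "verts (inserted_H Q) \<noteq> {}" by (auto simp: verts_inserted_H)
  fix A assume A: "A \<subseteq> verts (inserted_H Q) \<and> A \<noteq> {} \<and>
    (\<forall>x\<in>A. \<forall>y. {x, y} \<in> edges (inserted_H Q) \<longrightarrow> y \<in> A)"
  then have cl: "\<And>x y. x \<in> A \<Longrightarrow> {x, y} \<in> edges (inserted_H Q) \<Longrightarrow> y \<in> A" by blast
  obtain v where v: "v \<in> A" "v \<in> verts (inserted_H Q)" using A by blast
  have "\<exists>p\<in>Q. Hub p \<in> A"
  proof (cases "v \<in> Hub ` Q")
    case False
    then obtain e p where e: "v = Sub e" "p \<in> Q" "e \<in> p" using v by (auto simp: verts_inserted_H)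
    then have "Hub p \<in> A" using cl[OF v(1), of "Hub p"] by (simp add: inserted_H_adj)
    with e show ?thesis by blast
  qed (use v in auto)
  then obtain p' where "p' \<in> Q" "Hub p' \<in> A" by blast
  then have hubs: "Hub ` Q \<subseteq> A"
    using pq cl[of "Hub p" "Hub q"] cl[of "Hub q" "Hub p"] by (auto simp: inserted_H_adj)
  moreover have "Sub ` \<Union>Q \<subseteq> A"
  proof
    fix v assume "v \<in> Sub ` \<Union>Q"
    then obtain e p where "v = Sub e" "p \<in> Q" "e \<in> p" by blast
    then show "v \<in> A" using hubs cl[of "Hub p" v] by (auto simp: inserted_H_adj)
  qed
  ultimately show "A = verts (inserted_H Q)" using A by (auto simp: verts_inserted_H)
qed

text \<open>A vertex of degree 1 lies on no cycle, and the two hubs that remain are too few for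
  one.\<close>

lemma acyclic_inserted_H: "cycles (inserted_H Q) = {}"
proof (rule ccontr)
  assume "cycles (inserted_H Q) \<noteq> {}"
  then obtain vs where vs: "length vs \<ge> 3" "distinct vs" "subgraph (cycle_graph vs) (inserted_H Q)"
    by (auto simp: cycles_def)
  have "v \<in> Hub ` Q" if v: "v \<in> set vs" for v
  proof (rule ccontr)
    assume "v \<notin> Hub ` Q"
    then have "v \<in> Sub ` \<Union>Q" using v vs(3) by (auto simp: subgraph_def verts_inserted_H)
    then obtain e where e: "v = Sub e" "e \<in> \<Union>Q" by blast
    obtain u w where "u \<noteq> w" "{v, u} \<in> edges (cycle_graph vs)" "{v, w} \<in> edges (cycle_graph vs)"
      using cycle_two_neighbours[OF vs(1,2) v] by metis
    then have "{u, w} \<subseteq> nbrs (inserted_H Q) v" "card {u, w} = 2"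
      using vs(3) by (auto simp: nbrs_def subgraph_def)
    then have "2 \<le> degree (inserted_H Q) v"
      using card_mono[OF finite_nbrs[OF simple_inserted_H]] degree_eq_card_nbrs[OF simple_inserted_H]
      by metis
    then show False using degree_inserted_H_Sub[OF e(2)] e(1) by simp
  qed
  then have "set vs \<subseteq> Hub ` Q" by blast
  moreover have "finite Q" "card Q = 2" using quadruple_finite[OF Q] quadruple_card[OF Q] by auto
  ultimately have "card (set vs) \<le> 2"
    using card_mono[of "Hub ` Q" "set vs"] card_image_le[of Q Hub] by simp
  then show False using vs(1,2) by (simp add: distinct_card)
qed

lemma H_graph_inserted_H: "H_graph (inserted_H Q) (inserted_center Q)"
proof -
  have "card (verts (inserted_H Q)) = 6"
  proof -
    have "finite Q" using quadruple_finite[OF Q] quadruple_card[OF Q] by auto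
    moreover have "card (Hub ` Q) = 2" "card (Sub ` \<Union>Q) = 4"
      using quadruple_card[OF Q] quadruple_card_Union[OF Q] by (subst card_image; simp add: inj_on_def)+
    ultimately show ?thesis
      using quadruple_finite_Union[OF Q]
      unfolding verts_inserted_H by (subst card_Un_disjoint) auto
  qed
  moreover have "inserted_center Q \<in> edges (inserted_H Q)" by (simp add: inserted_H_def)
  ultimately show ?thesis
    using simple_inserted_H connected_inserted_H acyclic_inserted_H degree_inserted_H_Hub
    by (auto simp: H_graph_def inserted_center_def)
qed

text \<open>Subdividing vertices are pairwise non-adjacent, so a cycle through \<open>i\<close> of
  them has length at least \<open>2 * i\<close>, which is at least \<open>3 + i\<close> for
  \<open>i\<close> at least 3. For smaller \<open>i\<close> the girth bound 5 suffices.\<close>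

lemma reducible_inserted_H:
  assumes "enat 5 \<le> girth (H_insert G Q)" "good_edge (H_insert G Q) (inserted_center Q)"
  shows "reducible_H (H_insert G Q) (inserted_H Q) (inserted_center Q)"
proof -
  have "3 + card (verts C \<inter> endvertices (inserted_H Q)) \<le> cycle_length C"
    if C: "C \<in> cycles (H_insert G Q)" for C
  proof -
    have "2 * card (verts C \<inter> endvertices (inserted_H Q)) \<le> cycle_length C"
      using C by (rule cycle_independent) (auto simp: endvertices_inserted_H H_insert_Sub_Sub)
    moreover have "5 \<le> cycle_length C" using assms(1) C girth_ge_iff by blast
    ultimately show ?thesis by linarith
  qed
  then show ?thesis
    using H_graph_inserted_H subgraph_inserted_H assms(2) by (simp add: reducible_H_def)
qed

text \<open>Each hub is joined to a subdividing vertex, which survives the removal of the centre.\<close>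

lemma connected_H_insert:
  assumes "good_edge (H_insert G Q) (inserted_center Q)"
  shows "connected_graph (H_insert G Q)"
proof -
  let ?Y = "H_insert G Q" and ?K = "verts (H_insert G Q) - inserted_center Q"
  obtain p q where pq: "Q = {p, q}" using quadruple_card[OF Q] by (meson card_2_iff)
  have ne: "\<exists>e. e \<in> p" if "p \<in> Q" for p
    using quadruple_pair_card[OF Q that] by (metis card.empty ex_in_conv zero_neq_numeral)
  obtain e d where ed: "e \<in> p" "d \<in> q" using ne pq by blast
  have "connected_graph (induced ?Y ?K)" using assms by (simp add: good_edge_def)
  then have "connected_graph (induced ?Y (insert (Hub p) ?K))"
    by (rule connected_induced_insert[OF simple_H_insert, of _ _ "Sub e"])
      (use ed pq in \<open>auto simp: verts_H_insert inserted_center_def H_insert_adj'\<close>)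
  then have "connected_graph (induced ?Y (insert (Hub q) (insert (Hub p) ?K)))"
    by (rule connected_induced_insert[OF simple_H_insert, of _ _ "Sub d"])
      (use ed pq in \<open>auto simp: verts_H_insert inserted_center_def H_insert_adj'\<close>)
  moreover have "insert (Hub q) (insert (Hub p) ?K) = verts ?Y"
    using pq by (auto simp: verts_H_insert inserted_center_def)
  moreover have "induced ?Y (verts ?Y) = ?Y"
    using simple_edge_subset[OF simple_H_insert] by (cases ?Y) (auto simp: induced_def)
  ultimately show ?thesis by simp
qed

end

subsection \<open>Girth and deficit of the reduced graph\<close>

text \<open>Lifts paths rather than cycles: both ends stay old vertices, so the result can be closed
  in several ways, by an old edge, by one subdividing vertex, or through the hubs.\<close>

fun lift_path :: "'a set set \<Rightarrow> 'a list \<Rightarrow> 'a xvertex list" where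
  "lift_path F (x # y # r) = Old x # (if {x, y} \<in> F then [Sub {x, y}] else []) @ lift_path F (y # r)"
| "lift_path F [x] = [Old x]"
| "lift_path F [] = []"

lemma lift_path_ends:
  assumes "p \<noteq> []"
  shows "lift_path F p \<noteq> []" "hd (lift_path F p) = Old (hd p)" "last (lift_path F p) = Old (last p)"
  using assms by (induction F p rule: lift_path.induct) auto

lemma set_lift_path: "set (lift_path F p) = Old ` set p \<union> Sub ` (F \<inter> path_edges p)"
  by (induction F p rule: lift_path.induct) auto

lemma edge_notin_path_edges:
  assumes "\<not> e \<subseteq> set p"
  shows "e \<notin> path_edges p"
  using assms path_edges_subset by blast

lemma distinct_lift_path: "distinct p \<Longrightarrow> distinct (lift_path F p)"
proof (induction F p rule: lift_path.induct)
  case (1 F x y r)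
  then have "{x, y} \<notin> path_edges (y # r)" by (intro edge_notin_path_edges) auto
  moreover have "x \<notin> set (y # r)" using 1 by simp
  ultimately show ?case using 1 by (auto simp: set_lift_path simp del: path_edges.simps)
qed auto

text \<open>Distinctness prevents the path from using an edge twice, so the number of inserted
  vertices is the cardinality of a set of edges.\<close>

lemma length_lift_path:
  "distinct p \<Longrightarrow> length (lift_path F p) = length p + card (F \<inter> path_edges p)"
proof (induction F p rule: lift_path.induct)
  case (1 F x y r)
  then have "{x, y} \<notin> path_edges (y # r)" by (intro edge_notin_path_edges) auto
  then have "card (F \<inter> insert {x, y} (path_edges (y # r))) =
      (if {x, y} \<in> F then 1 else 0) + card (F \<inter> path_edges (y # r))"
    using finite_path_edges[of "y # r"] by (simp del: path_edges.simps)
  then show ?case using 1 by simp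
qed auto

lemma path_edges_lift_path:
  assumes "path_edges p \<subseteq> edges G"
  shows "path_edges (lift_path (\<Union>Q) p) \<subseteq> edges (H_insert G Q)"
  using assms
proof (induction "\<Union>Q" p rule: lift_path.induct)
  case (1 x y r)
  let ?l = "lift_path (\<Union>Q) (y # r)"
  have IH: "path_edges ?l \<subseteq> edges (H_insert G Q)" and xy: "{x, y} \<in> edges G" using 1 by auto
  have l: "?l \<noteq> []" "hd ?l = Old y" using lift_path_ends[of "y # r"] by simp_all
  show ?case
  proof (cases "{x, y} \<in> \<Union>Q")
    case True
    have "path_edges ([Old x, Sub {x, y}] @ ?l) =
        insert {Sub {x, y}, Old y} (insert {Old x, Sub {x, y}} (path_edges ?l))"
      using l by (subst path_edges_append) auto
    then show ?thesis using True IH by (simp add: H_insert_adj H_insert_adj' del: Union_iff)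
  next
    case False
    have "path_edges ([Old x] @ ?l) = insert {Old x, Old y} (path_edges ?l)"
      using l by (subst path_edges_append) auto
    then show ?thesis using False IH xy by (simp add: H_insert_adj del: Union_iff)
  qed
qed auto

text \<open>Split the list at a second occurrence of the closing edge. The two parts are disjoint,
  so each would begin and end in the same vertex, leaving only two vertices in all.\<close>

lemma closing_edge_notin_path_edges:
  assumes "distinct vs" "length vs \<ge> 3"
  shows "{last vs, hd vs} \<notin> path_edges vs"
proof
  assume "{last vs, hd vs} \<in> path_edges vs"
  then obtain p q where pq: "vs = p @ q" "p \<noteq> []" "q \<noteq> []" "{last vs, hd vs} = {last p, hd q}"
    using path_edges_split by blast
  then have eq: "{last q, hd p} = {last p, hd q}" by simp
  have "set p \<inter> set q = {}" using assms(1) pq(1) by simp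
  moreover have "last q \<in> set q" "hd p \<in> set p" "last p \<in> set p" "hd q \<in> set q" using pq by auto
  ultimately have "last q = hd q" "hd p = last p" using eq by (auto simp: doubleton_eq_iff)
  moreover have "length r \<le> 1" if "distinct r" "last r = hd r" for r :: "'a list"
    using that by (cases r) (auto split: if_splits)
  ultimately have "length p \<le> 1" "length q \<le> 1" using assms(1) pq(1) by auto
  then show False using assms(2) pq(1) by simp
qed

lemma cycle_with_closing_edge:
  assumes "C \<in> cycles G" "e \<in> edges C"
  obtains vs where "C = cycle_graph vs" "length vs \<ge> 3" "distinct vs" "e = {last vs, hd vs}"
    "path_edges vs \<subseteq> edges G" "set vs \<subseteq> verts G"
proof -
  obtain us where us: "C = cycle_graph us" "length us \<ge> 3" "distinct us"
    using assms(1) by (auto elim: in_cyclesE)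
  have "\<exists>vs. C = cycle_graph vs \<and> length vs \<ge> 3 \<and> distinct vs \<and> e = {last vs, hd vs}"
  proof (cases "e = {last us, hd us}")
    case True with us show ?thesis by blast
  next
    case False
    then have "e \<in> path_edges us" using assms(2) us(2) by (subst (asm) us(1), subst (asm) edges_cycle_graph) auto
    then obtain p q where pq: "us = p @ q" "p \<noteq> []" "q \<noteq> []" "e = {last p, hd q}"
      using path_edges_split by blast
    then have "C = cycle_graph (q @ p)" using cycle_graph_swap us(1) by metis
    moreover have "length (q @ p) \<ge> 3" "distinct (q @ p)" using us(2,3) pq(1) by auto
    moreover have "e = {last (q @ p), hd (q @ p)}" using pq by simp
    ultimately show ?thesis by blast
  qed
  then obtain vs where vs: "C = cycle_graph vs" "length vs \<ge> 3" "distinct vs" "e = {last vs, hd vs}"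
    by blast
  then have "vs \<noteq> []" by auto
  then have "path_edges vs \<subseteq> edges G" "set vs \<subseteq> verts G"
    using cycles_subset[OF assms(1)] vs(1) by (auto simp: edges_cycle_graph)
  with vs show ?thesis using that by blast
qed

section \<open>Lower bounds for cycles of the original graph\<close>

context
  fixes G :: "'a graph" and Q and k :: nat
  assumes G: "simple_graph G" and Q: "Q \<in> edge_quadruples G"
    and girth: "enat k \<le> girth (H_insert G Q)"
begin

text \<open>A cycle that uses \<open>i\<close> subdivided edges lifts to a cycle that is longer by \<open>i\<close>.\<close>

lemma cycle_length_lower:
  assumes C: "C \<in> cycles G"
  shows "k \<le> cycle_length C + card (\<Union>Q \<inter> edges C)"
proof (cases "\<Union>Q \<inter> edges C = {}")
  case True
  obtain vs where vs: "C = cycle_graph vs" "length vs \<ge> 3" "distinct vs"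
    "path_edges vs \<subseteq> edges G" "{last vs, hd vs} \<in> edges G"
    using C by (auto elim: in_cyclesE)
  have ne: "vs \<noteq> []" using vs(2) by auto
  let ?l = "lift_path (\<Union>Q) vs"
  have no: "\<Union>Q \<inter> path_edges vs = {}" "{last vs, hd vs} \<notin> \<Union>Q"
    using True ne by (auto simp: vs(1) edges_cycle_graph)
  have len: "length ?l = length vs" using length_lift_path[OF vs(3), of "\<Union>Q"] no(1) by simp
  have "k \<le> length ?l"
    by (rule girth_length[OF girth simple_H_insert[OF G Q]])
      (use vs len no(2) path_edges_lift_path[OF vs(4)] distinct_lift_path[OF vs(3)] lift_path_ends[OF ne]
       in \<open>simp_all add: H_insert_adj del: Union_iff\<close>)
  then show ?thesis using True len vs(1) cycle_length_cycle_graph[OF vs(3)] by simp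
next
  case False
  then obtain e where e: "e \<in> \<Union>Q" "e \<in> edges C" by blast
  \<comment> \<open>Rotated so that a subdivided edge closes the cycle: \<open>lift_path\<close>
    does not see the closing edge, whose vertex \<open>Sub e\<close> is appended separately.\<close>
  obtain vs where vs: "C = cycle_graph vs" "length vs \<ge> 3" "distinct vs" "e = {last vs, hd vs}"
    "path_edges vs \<subseteq> edges G"
    using cycle_with_closing_edge[OF C e(2)] by metis
  have ne: "vs \<noteq> []" using vs(2) by auto
  have enot: "e \<notin> path_edges vs" using closing_edge_notin_path_edges[OF vs(3,2)] vs(4) by simp
  let ?l = "lift_path (\<Union>Q) vs"
  note ends = lift_path_ends[OF ne]
  have "k \<le> length (?l @ [Sub e])"
  proof (rule girth_length[OF girth simple_H_insert[OF G Q]])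
    show "3 \<le> length (?l @ [Sub e])" using vs(2) length_lift_path[OF vs(3)] by simp
    show "distinct (?l @ [Sub e])" using distinct_lift_path[OF vs(3)] enot by (auto simp: set_lift_path)
    show "path_edges (?l @ [Sub e]) \<subseteq> edges (H_insert G Q)"
      using path_edges_lift_path[OF vs(5)] ends e(1) vs(4)
      by (subst path_edges_append) (auto simp: H_insert_adj)
    show "{last (?l @ [Sub e]), hd (?l @ [Sub e])} \<in> edges (H_insert G Q)"
      using ends e(1) vs(4) by (auto simp: H_insert_adj')
  qed
  also have "\<dots> = length vs + Suc (card (\<Union>Q \<inter> path_edges vs))"
    using length_lift_path[OF vs(3)] by simp
  also have "\<Union>Q \<inter> edges C = insert e (\<Union>Q \<inter> path_edges vs)"
    using e(1) ne by (auto simp: vs(1,4) edges_cycle_graph)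
  then have "Suc (card (\<Union>Q \<inter> path_edges vs)) = card (\<Union>Q \<inter> edges C)"
    using enot finite_path_edges[of vs] by simp
  finally show ?thesis using vs(1) cycle_length_cycle_graph[OF vs(3)] by simp
qed

text \<open>A path between two subdivided edges is closed up through one or two hubs.\<close>

lemma arc_length_lower:
  assumes p: "p \<noteq> []" "distinct p" "path_edges p \<subseteq> edges G"
    and e: "e \<in> s" "s \<in> Q" "hd p \<in> e" "e \<notin> path_edges p"
    and f: "f \<in> t" "t \<in> Q" "last p \<in> f" "f \<notin> path_edges p" and "e \<noteq> f"
  shows "k \<le> length p + card (\<Union>Q \<inter> path_edges p) + (if s = t then 3 else 4)"
proof -
  let ?l = "lift_path (\<Union>Q) p"
  \<comment> \<open>One hub if both edges belong to the same pair, otherwise both hubs and the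
    central edge. Together with \<open>Sub e\<close> and \<open>Sub f\<close> this adds 3 or 4
    vertices to the lifted path.\<close>
  let ?hs = "if s = t then [Hub s] else [Hub t, Hub s]"
  let ?ws = "(Sub e # ?l) @ (Sub f # ?hs)"
  note ends = lift_path_ends[OF p(1)]
  have Qst: "s \<noteq> t \<Longrightarrow> Q = {t, s}" using quadruple_eq_iff[OF Q f(2)] e(2) by auto
  have "path_edges (Sub e # ?l) = insert {Sub e, Old (hd p)} (path_edges ?l)"
    using ends path_edges_append[of "[Sub e]" ?l] by simp
  then have pe: "path_edges ?ws = insert {Old (last p), Sub f} (insert {Sub e, Old (hd p)}
      (path_edges ?l \<union> path_edges (Sub f # ?hs)))"
    using ends by (subst path_edges_append) auto
  have "k \<le> length ?ws"
  proof (rule girth_length[OF girth simple_H_insert[OF G Q]])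
    show "3 \<le> length ?ws" by simp
    show "distinct ?ws"
      using distinct_lift_path[OF p(2)] e(4) f(4) \<open>e \<noteq> f\<close> by (auto simp: set_lift_path)
    show "path_edges ?ws \<subseteq> edges (H_insert G Q)"
      unfolding pe using path_edges_lift_path[OF p(3)] e f Qst
      by (auto simp: H_insert_adj H_insert_adj')
    show "{last ?ws, hd ?ws} \<in> edges (H_insert G Q)"
      using e by (auto simp: H_insert_adj H_insert_adj')
  qed
  then show ?thesis using length_lift_path[OF p(2), of "\<Union>Q"] by (simp split: if_splits)
qed

text \<open>With exactly two subdivided edges each arc is closed by at most 4 vertices: 4 + 4. With
  three or four, two of them lie in the same pair, each arc needs only 3, and the at most two other
  edges lengthen the arcs: 3 + 3 + 2. Either way 8.\<close>

lemma cycle_length_two_subdivided: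
  assumes C: "C \<in> cycles G" and two: "2 \<le> card (\<Union>Q \<inter> edges C)"
  shows "2 * k \<le> cycle_length C + 8"
proof -
  let ?F = "\<Union>Q \<inter> edges C"
  have finF: "finite ?F" using quadruple_finite_Union[OF Q] by simp
  have "\<exists>e f s t. e \<in> ?F \<and> f \<in> ?F \<and> e \<noteq> f \<and> e \<in> s \<and> f \<in> t \<and> s \<in> Q \<and> t \<in> Q \<and> (card ?F \<noteq> 2 \<longrightarrow> s = t)"
  proof (cases "card ?F = 2")
    case True
    then obtain e f where "?F = {e, f}" "e \<noteq> f" by (meson card_2_iff)
    then have "e \<in> ?F" "f \<in> ?F" by auto
    with \<open>e \<noteq> f\<close> True show ?thesis by blast
  next
    case False
    have "\<forall>e\<in>?F. \<exists>s. s \<in> Q \<and> e \<in> s" by auto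
    then obtain g where g: "\<And>e. e \<in> ?F \<Longrightarrow> g e \<in> Q \<and> e \<in> g e" using bchoice by metis
    \<comment> \<open>Pigeonhole: at least three edges are distributed over two pairs.\<close>
    have "\<not> inj_on g ?F"
    proof
      assume "inj_on g ?F"
      then have "card ?F \<le> card Q"
        using g quadruple_finite[OF Q] by (intro card_inj_on_le[of g]) auto
      then show False using False two quadruple_card[OF Q] by simp
    qed
    then obtain e f where "e \<in> ?F" "f \<in> ?F" "e \<noteq> f" "g e = g f" unfolding inj_on_def by blast
    with g[of e] g[of f] show ?thesis by metis
  qed
  then obtain e f s t where ef: "e \<in> ?F" "f \<in> ?F" "e \<noteq> f" "e \<in> s" "f \<in> t" "s \<in> Q" "t \<in> Q"
    and st: "card ?F \<noteq> 2 \<longrightarrow> s = t" by metis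
  have "e \<in> edges C" using ef(1) by simp
  then obtain vs where vs: "C = cycle_graph vs" "length vs \<ge> 3" "distinct vs" "e = {last vs, hd vs}"
    "path_edges vs \<subseteq> edges G"
    using cycle_with_closing_edge[OF C] by metis
  have ne: "vs \<noteq> []" using vs(2) by auto
  have eC: "edges C = insert e (path_edges vs)" using ne by (simp add: vs(1,4) edges_cycle_graph)
  have enot: "e \<notin> path_edges vs" using closing_edge_notin_path_edges[OF vs(3,2)] vs(4) by simp
  have "f \<in> path_edges vs" using ef(2,3) eC by auto
  then obtain p q where pq: "vs = p @ q" "p \<noteq> []" "q \<noteq> []" "f = {last p, hd q}"
    using path_edges_split by metis
  have pe: "path_edges vs = insert f (path_edges p \<union> path_edges q)"
    using path_edges_append[OF pq(2,3)] pq(1,4) by simp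
  have disj: "set p \<inter> set q = {}" and dis: "distinct p" "distinct q" using vs(3) pq(1) by auto
  have lh: "last p \<in> set p" "hd q \<in> set q" using pq by auto
  have fnot: "f \<notin> path_edges p" "f \<notin> path_edges q"
    using disj lh pq(4) by (auto intro!: edge_notin_path_edges)
  \<comment> \<open>The arcs share no vertex and edges are non-empty, so the other subdivided edges
    are counted on one arc only.\<close>
  have pp: "path_edges p \<inter> path_edges q = {}"
  proof (rule ccontr)
    assume "path_edges p \<inter> path_edges q \<noteq> {}"
    then obtain d where d: "d \<in> path_edges p" "d \<in> path_edges q" by blast
    then have "d \<subseteq> set p \<inter> set q" using path_edges_subset[of d p] path_edges_subset[of d q] by blast
    then have "d = {}" using disj by blast
    moreover have "d \<in> edges G" using d(1) pe vs(5) by blast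
    ultimately show False using G by (auto simp: simple_graph_def)
  qed
  have "?F = insert e (insert f ((\<Union>Q \<inter> path_edges p) \<union> (\<Union>Q \<inter> path_edges q)))"
    using ef(1,2) eC pe by blast
  then have "card ?F = Suc (Suc (card ((\<Union>Q \<inter> path_edges p) \<union> (\<Union>Q \<inter> path_edges q))))"
    using ef(3) enot fnot pe finite_path_edges[of p] finite_path_edges[of q] by simp
  also have "card ((\<Union>Q \<inter> path_edges p) \<union> (\<Union>Q \<inter> path_edges q)) =
      card (\<Union>Q \<inter> path_edges p) + card (\<Union>Q \<inter> path_edges q)"
    using pp finite_path_edges[of p] finite_path_edges[of q] by (intro card_Un_disjoint) auto
  finally have cF: "card ?F = 2 + card (\<Union>Q \<inter> path_edges p) + card (\<Union>Q \<inter> path_edges q)" by simp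
  have "hd p \<in> e" "last q \<in> e" "last p \<in> f" "hd q \<in> f" using vs(4) pq by auto
  then have "k \<le> length p + card (\<Union>Q \<inter> path_edges p) + (if s = t then 3 else 4)"
    and "k \<le> length q + card (\<Union>Q \<inter> path_edges q) + (if t = s then 3 else 4)"
    using arc_length_lower[of p e s f t] arc_length_lower[of q f t e s] ef pq dis fnot enot pe vs(5)
    by auto
  moreover have "length vs = length p + length q" using pq(1) by simp
  moreover have "card ?F \<le> 4"
    using card_mono[OF quadruple_finite_Union[OF Q], of ?F] quadruple_card_Union[OF Q] by simp
  moreover have "cycle_length C = length vs" using vs(1) cycle_length_cycle_graph[OF vs(3)] by simp
  ultimately show ?thesis using cF st by (auto split: if_splits)
qed

text \<open>At most one subdivided edge costs at most 1. Otherwise the bound is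
  \<open>2 * k - 8\<close>, which reaches \<open>k - 1\<close> from \<open>k = 7\<close> on and
  equals \<open>k - 2\<close> for \<open>k = 6\<close>. For \<open>k = 5\<close> the bound 3 holds
  for every cycle.\<close>

lemma girth_reduced:
  assumes "k \<ge> 5"
  shows "enat (if k \<in> {5, 6} then k - 2 else k - 1) \<le> girth G"
  unfolding girth_ge_iff
proof
  fix C assume C: "C \<in> cycles G"
  have "3 \<le> cycle_length C" using C by (auto elim!: in_cyclesE simp: cycle_length_cycle_graph)
  moreover have "k - 1 \<le> cycle_length C \<or> 2 * k \<le> cycle_length C + 8"
    using cycle_length_lower[OF C] cycle_length_two_subdivided[OF C] by linarith
  ultimately show "(if k \<in> {5, 6} then k - 2 else k - 1) \<le> cycle_length C"
    using assms by auto
qed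

lemma deficit_reduced: "deficit k G \<le> 4"
proof -
  let ?V = "{(\<Sum>C\<in>\<C>. cycle_deficit k C) | \<C>.
     \<C> \<subseteq> cycles G \<and> pairwise (\<lambda>C D. verts C \<inter> verts D = {}) \<C>}"
  have le: "v \<le> 4" if v: "v \<in> ?V" for v
  proof -
    obtain \<C> where \<C>: "v = (\<Sum>C\<in>\<C>. cycle_deficit k C)" "\<C> \<subseteq> cycles G"
      "pairwise (\<lambda>C D. verts C \<inter> verts D = {}) \<C>" using v by blast
    show ?thesis
    \<comment> \<open>A sum over an infinite collection is 0 by convention, so only finite
      collections need an argument.\<close>
    proof (cases "finite \<C>")
      case True
      have "cycle_deficit k C \<le> card (\<Union>Q \<inter> edges C)" if "C \<in> \<C>" for C
        using cycle_length_lower[of C] that \<C>(2) by (auto simp: cycle_deficit_def)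
      then have "v \<le> (\<Sum>C\<in>\<C>. card (\<Union>Q \<inter> edges C))" unfolding \<C>(1) by (rule sum_mono)
      also have "\<dots> = card (\<Union>C\<in>\<C>. \<Union>Q \<inter> edges C)"
      proof (rule card_UN_disjoint[symmetric, OF True])
        show "\<forall>C\<in>\<C>. finite (\<Union>Q \<inter> edges C)" using quadruple_finite_Union[OF Q] by simp
        show "\<forall>C\<in>\<C>. \<forall>D\<in>\<C>. C \<noteq> D \<longrightarrow> (\<Union>Q \<inter> edges C) \<inter> (\<Union>Q \<inter> edges D) = {}"
        proof (intro ballI impI, rule ccontr)
          fix C D assume CD: "C \<in> \<C>" "D \<in> \<C>" "C \<noteq> D"
            and "(\<Union>Q \<inter> edges C) \<inter> (\<Union>Q \<inter> edges D) \<noteq> {}"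
          then obtain e where e: "e \<in> edges C" "e \<in> edges D" by blast
          \<comment> \<open>A common edge would lie in both vertex sets. So disjoint cycles use
            disjoint parts of the four subdivided edges, and their deficits add up to at most
            4.\<close>
          have "e \<subseteq> verts B" if B: "B \<in> cycles G" "e \<in> edges B" for B
          proof -
            obtain vs where "B = cycle_graph vs" "e = {last vs, hd vs}" "length vs \<ge> 3"
              using cycle_with_closing_edge[OF B] by metis
            then show ?thesis by (cases vs) auto
          qed
          then have "e \<subseteq> verts C \<inter> verts D" using CD e \<C>(2) by blast
          moreover have "verts C \<inter> verts D = {}" using \<C>(3) CD by (auto simp: pairwise_def)
          moreover have "e \<in> edges G" using e(1) CD(1) \<C>(2) cycles_subset(2) by blast
          ultimately show False using G by (auto simp: simple_graph_def)
        qed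
      qed
      also have "\<dots> \<le> card (\<Union>Q)" by (rule card_mono[OF quadruple_finite_Union[OF Q]]) auto
      finally show ?thesis using quadruple_card_Union[OF Q] by simp
    qed (simp add: \<C>(1))
  qed
  \<comment> \<open>\<open>Max\<close> is meaningful only on a finite non-empty set: the bound
    itself gives finiteness, and the empty collection contributes the value 0.\<close>
  then have "finite ?V" by (intro finite_subset[of ?V "{..4}"]) auto
  moreover have "?V \<noteq> {}" by (auto intro!: exI[of _ "{}"])
  ultimately show ?thesis unfolding deficit_def using le by (intro Max.boundedI)
qed

end

subsection \<open>Insertion and isomorphisms\<close>

lemma quadrupleI:
  "distinct [e1, e2, e3, e4] \<Longrightarrow> {e1, e2, e3, e4} \<subseteq> edges G \<Longrightarrow> {{e1, e2}, {e3, e4}} \<in> edge_quadruples G"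
  unfolding edge_quadruples_def by blast

lemma graph_isoI:
  assumes G: "simple_graph G" and H: "simple_graph H" and bij: "bij_betw f (verts G) (verts H)"
    and adj: "\<And>x y. x \<in> verts G \<Longrightarrow> y \<in> verts G \<Longrightarrow> {f x, f y} \<in> edges H \<longleftrightarrow> {x, y} \<in> edges G"
  shows "graph_iso f G H"
proof -
  have "(`) f ` edges G = edges H"
  proof (intro equalityI subsetI)
    fix e assume "e \<in> (`) f ` edges G"
    then obtain d where d: "d \<in> edges G" "e = f ` d" by blast
    obtain x y where "d = {x, y}" "x \<in> verts G" "y \<in> verts G" using simple_edgeE[OF G d(1)] by metis
    then show "e \<in> edges H" using d adj by simp
  next
    fix e assume e: "e \<in> edges H"
    obtain u v where uv: "e = {u, v}" "u \<in> verts H" "v \<in> verts H" using simple_edgeE[OF H e] by metis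
    have "verts H = f ` verts G" using bij by (simp add: bij_betw_def)
    then obtain x y where "u = f x" "v = f y" "x \<in> verts G" "y \<in> verts G" using uv by auto
    then show "e \<in> (`) f ` edges G" using adj e uv(1) by (intro image_eqI[of _ _ "{x, y}"]) auto
  qed
  with bij show ?thesis by (simp add: graph_iso_def)
qed

text \<open>This makes the insertion functorial: an isomorphism that carries one quadruple to
  another extends to the expanded graphs, with no new names to choose.\<close>

fun xmap :: "('a \<Rightarrow> 'b) \<Rightarrow> 'a xvertex \<Rightarrow> 'b xvertex" where
  "xmap f (Old x) = Old (f x)"
| "xmap f (Sub e) = Sub (f ` e)"
| "xmap f (Hub p) = Hub ((`) f ` p)"

lemma xmap_center: "xmap f ` inserted_center Q = inserted_center ((`) ((`) f) ` Q)"
  by (simp add: inserted_center_def image_image)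

context
  fixes f :: "'a \<Rightarrow> 'b" and G H Q
  assumes iso: "graph_iso f G H" and G: "simple_graph G" and Q: "Q \<in> edge_quadruples G"
begin

lemma quadruple_sets: "p \<in> Q \<Longrightarrow> p \<subseteq> Pow (verts G)" "e \<in> \<Union>Q \<Longrightarrow> e \<subseteq> verts G" "\<Union>Q \<subseteq> Pow (verts G)"
  using quadruple_Union_subset[OF Q] simple_edge_subset[OF G] by blast+

lemma inj_images:
  shows "inj_on ((`) f) (Pow (verts G))" "inj_on ((`) ((`) f)) (Pow (Pow (verts G)))"
  by (intro inj_on_image_Pow graph_iso_inj[OF iso])+

lemma iso_quadruple: "(`) ((`) f) ` Q \<in> edge_quadruples H"
proof -
  obtain e1 e2 e3 e4 where E: "Q = {{e1, e2}, {e3, e4}}" "distinct [e1, e2, e3, e4]"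
    "{e1, e2, e3, e4} \<subseteq> edges G" using quadrupleE[OF Q] by metis
  have "set [e1, e2, e3, e4] \<subseteq> Pow (verts G)" using E(3) simple_edge_subset[OF G] by auto
  then have "inj_on ((`) f) (set [e1, e2, e3, e4])" by (rule inj_on_subset[OF inj_images(1)])
  then have "distinct (map ((`) f) [e1, e2, e3, e4])" using E(2) by (simp only: distinct_map)
  moreover have "{f ` e1, f ` e2, f ` e3, f ` e4} \<subseteq> edges H"
    using E(3) by (auto simp: graph_iso_edges[OF iso])
  moreover have "(`) ((`) f) ` Q = {{f ` e1, f ` e2}, {f ` e3, f ` e4}}" using E(1) by simp
  ultimately show ?thesis using quadrupleI by (simp only: list.map)
qed

text \<open>Each adjacency of the expanded graph is a membership or an equality among vertices,
  edges and pairs. All of these are built from vertices of \<open>G\<close>, so \<open>f\<close> is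
  injective on each of the three levels.\<close>

lemma iso_H_insert: "graph_iso (xmap f) (H_insert G Q) (H_insert H ((`) ((`) f) ` Q))"
proof (rule graph_isoI)
  let ?Q' = "(`) ((`) f) ` Q"
  have U: "\<Union>?Q' = (`) f ` \<Union>Q" by blast
  have mem_e: "f x \<in> f ` e \<longleftrightarrow> x \<in> e" if "x \<in> verts G" "e \<subseteq> verts G" for x e
    using iso_image_mem[OF iso G that] .
  have mem_p: "f ` e \<in> (`) f ` p \<longleftrightarrow> e \<in> p" if "e \<subseteq> verts G" "p \<subseteq> Pow (verts G)" for e p
    using that inj_on_image_mem_iff[OF inj_images(1), of e p] by simp
  have mem_Q: "(`) f ` p \<in> ?Q' \<longleftrightarrow> p \<in> Q" if "p \<subseteq> Pow (verts G)" for p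
    by (rule inj_on_image_mem_iff[OF inj_images(2)]) (use that quadruple_sets(1) in auto)
  have eq_Q: "?Q' = {(`) f ` p, (`) f ` q} \<longleftrightarrow> Q = {p, q}" if "p \<in> Q" "q \<in> Q" for p q
  proof -
    have "(`) ((`) f) ` Q = (`) ((`) f) ` {p, q} \<longleftrightarrow> Q = {p, q}"
      by (rule inj_on_image_eq_iff[OF inj_images(2)]) (use that quadruple_sets(1) in auto)
    then show ?thesis by simp
  qed
  show "simple_graph (H_insert G Q)" using simple_H_insert[OF G Q] .
  show "simple_graph (H_insert H ?Q')" using simple_H_insert[OF iso_simple[OF iso G] iso_quadruple] .
  show "bij_betw (xmap f) (verts (H_insert G Q)) (verts (H_insert H ?Q'))"
    unfolding bij_betw_def
  proof
    have "v = w" if "v \<in> verts (H_insert G Q)" "w \<in> verts (H_insert G Q)" "xmap f v = xmap f w" for v w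
    proof (cases v; cases w)
      fix x y assume "v = Old x" "w = Old y"
      with that show ?thesis using inj_onD[OF graph_iso_inj[OF iso]] by (auto simp: verts_H_insert)
    next
      fix e d assume "v = Sub e" "w = Sub d"
      with that show ?thesis
        using inj_onD[OF inj_images(1), of e d] quadruple_sets(3) by (auto simp: verts_H_insert)
    next
      fix p q assume "v = Hub p" "w = Hub q"
      with that show ?thesis
        using inj_onD[OF inj_images(2), of p q] quadruple_sets(1) by (auto simp: verts_H_insert)
    qed (use that in auto)
    then show "inj_on (xmap f) (verts (H_insert G Q))" by (rule inj_onI)
    show "xmap f ` verts (H_insert G Q) = verts (H_insert H ?Q')"
      unfolding verts_H_insert U by (simp add: image_Un image_image graph_iso_verts[OF iso] del: Union_iff)
  qed
  fix v w assume v: "v \<in> verts (H_insert G Q)" and w: "w \<in> verts (H_insert G Q)"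
  have oo: "{f x, f y} \<in> edges H - \<Union>?Q' \<longleftrightarrow> {x, y} \<in> edges G - \<Union>Q"
    if "x \<in> verts G" "y \<in> verts G" for x y
    using iso_adj[OF iso G that] mem_p[of "{x, y}" "\<Union>Q"] that quadruple_sets(3) unfolding U by simp
  have os: "f ` e \<in> \<Union>?Q' \<and> f x \<in> f ` e \<longleftrightarrow> e \<in> \<Union>Q \<and> x \<in> e" if "x \<in> verts G" "e \<in> \<Union>Q" for x e
    using mem_p[OF quadruple_sets(2)[OF that(2)] quadruple_sets(3)] mem_e[OF that(1) quadruple_sets(2)[OF that(2)]]
    unfolding U by simp
  have sh: "(`) f ` p \<in> ?Q' \<and> f ` e \<in> (`) f ` p \<longleftrightarrow> p \<in> Q \<and> e \<in> p" if "p \<in> Q" "e \<in> \<Union>Q" for p e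
    using mem_p[OF quadruple_sets(2)[OF that(2)] quadruple_sets(1)[OF that(1)]]
      mem_Q[OF quadruple_sets(1)[OF that(1)]] by simp
  have mem: "Old x \<in> verts (H_insert G Q) \<longleftrightarrow> x \<in> verts G"
    "Sub e \<in> verts (H_insert G Q) \<longleftrightarrow> e \<in> \<Union>Q" "Hub p \<in> verts (H_insert G Q) \<longleftrightarrow> p \<in> Q" for x e p
    by (auto simp: verts_H_insert)
  show "{xmap f v, xmap f w} \<in> edges (H_insert H ?Q') \<longleftrightarrow> {v, w} \<in> edges (H_insert G Q)"
    using v w
    by (cases v; cases w)
      (simp_all only: mem xmap.simps H_insert_adj H_insert_adj' oo os sh eq_Q)
qed

end

text \<open>The centre determines the insertion: it singles out the hubs, then their neighbours, the
  subdividing vertices, and the remaining vertices are the old ones.\<close>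

lemma H_insert_iso_descends:
  fixes G1 :: "'a graph" and G2 :: "'b graph"
  assumes G1: "simple_graph G1" "Q1 \<in> edge_quadruples G1"
    and G2: "simple_graph G2" "Q2 \<in> edge_quadruples G2"
    and iso: "graph_iso \<phi> (H_insert G1 Q1) (H_insert G2 Q2)"
    and center: "\<phi> ` inserted_center Q1 = inserted_center Q2"
  obtains f where "graph_iso f G1 G2" "(`) ((`) f) ` Q1 = Q2"
proof -
  let ?Y1 = "H_insert G1 Q1" and ?Y2 = "H_insert G2 Q2"
  note Y1 = simple_H_insert[OF G1] and Y2 = simple_H_insert[OF G2]
  note inj = graph_iso_inj[OF iso] and V = graph_iso_verts[OF iso]
  note adj = iso_adj[OF iso Y1]
  have hub: "\<phi> v \<in> Hub ` Q2 \<longleftrightarrow> v \<in> Hub ` Q1" if "v \<in> verts ?Y1" for v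
    using center inj_on_image_mem_iff[OF inj that, of "Hub ` Q1"]
    by (auto simp: inserted_center_def verts_H_insert)
  have "\<exists>q. \<phi> (Hub p) = Hub q \<and> q \<in> Q2" if "p \<in> Q1" for p
    using hub[of "Hub p"] that by (auto simp: verts_H_insert)
  then obtain t where t: "\<And>p. p \<in> Q1 \<Longrightarrow> \<phi> (Hub p) = Hub (t p)" "\<And>p. p \<in> Q1 \<Longrightarrow> t p \<in> Q2"
    by metis
  have tQ: "t ` Q1 = Q2"
  proof -
    have "Hub ` t ` Q1 = \<phi> ` Hub ` Q1" using t(1) by (simp add: image_image cong: image_cong)
    then have "Hub ` t ` Q1 = Hub ` Q2" using center by (simp add: inserted_center_def)
    then show ?thesis by (subst (asm) inj_image_eq_iff) (auto simp: inj_def)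
  qed
  \<comment> \<open>The image is adjacent to a hub and is no hub itself, which only subdividing
    vertices satisfy.\<close>
  have "\<exists>d. \<phi> (Sub e) = Sub d \<and> d \<in> \<Union>Q2" if e: "e \<in> \<Union>Q1" for e
  proof -
    obtain p where p: "p \<in> Q1" "e \<in> p" using e by blast
    have ve: "Sub e \<in> verts ?Y1" "Hub p \<in> verts ?Y1" using e p by (auto simp: verts_H_insert)
    have "{\<phi> (Sub e), Hub (t p)} \<in> edges ?Y2"
      using adj[OF ve] p t by (simp add: H_insert_adj)
    moreover have "\<phi> (Sub e) \<notin> Hub ` Q2" using hub[OF ve(1)] by auto
    moreover have "\<phi> (Sub e) \<in> verts ?Y2" using ve V by auto
    ultimately show ?thesis by (auto simp: verts_H_insert H_insert_adj)
  qed
  then obtain s where s: "\<And>e. e \<in> \<Union>Q1 \<Longrightarrow> \<phi> (Sub e) = Sub (s e)" "\<And>e. e \<in> \<Union>Q1 \<Longrightarrow> s e \<in> \<Union>Q2"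
    by metis
  have "\<exists>y. \<phi> (Old x) = Old y \<and> y \<in> verts G2" if x: "x \<in> verts G1" for x
  proof -
    have vx: "Old x \<in> verts ?Y1" using x by (auto simp: verts_H_insert)
    \<comment> \<open>\<open>Sub d\<close> has a hub as a neighbour; pulled back along \<phi> this
      would make \<open>Old x\<close> adjacent to a hub.\<close>
    have "\<phi> (Old x) \<noteq> Sub d" if d: "d \<in> \<Union>Q2" for d
    proof
      assume eq: "\<phi> (Old x) = Sub d"
      obtain p where p: "p \<in> Q1" "d \<in> t p" using d tQ by blast
      then have "{\<phi> (Old x), \<phi> (Hub p)} \<in> edges ?Y2" using eq t by (simp add: H_insert_adj)
      then show False using adj[OF vx, of "Hub p"] p(1) by (auto simp: verts_H_insert H_insert_adj)
    qed
    moreover have "\<phi> (Old x) \<notin> Hub ` Q2" using hub[OF vx] by auto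
    moreover have "\<phi> (Old x) \<in> verts ?Y2" using vx V by auto
    ultimately show ?thesis by (auto simp: verts_H_insert)
  qed
  then obtain f where f: "\<And>x. x \<in> verts G1 \<Longrightarrow> \<phi> (Old x) = Old (f x)" "\<And>x. x \<in> verts G1 \<Longrightarrow> f x \<in> verts G2"
    by metis
  have finj: "inj_on f (verts G1)"
  proof (rule inj_onI)
    fix x y assume xy: "x \<in> verts G1" "y \<in> verts G1" "f x = f y"
    then have "\<phi> (Old x) = \<phi> (Old y)" using f(1) by simp
    then show "x = y" using inj_onD[OF inj, of "Old x" "Old y"] xy by (auto simp: verts_H_insert)
  qed
  have fV: "f ` verts G1 = verts G2"
  proof (intro equalityI subsetI)
    fix y assume y: "y \<in> verts G2"
    then have "Old y \<in> verts ?Y2" by (simp add: verts_H_insert)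
    then have "Old y \<in> \<phi> ` verts ?Y1" unfolding V .
    then obtain v where v: "v \<in> verts ?Y1" "\<phi> v = Old y" by auto
    have "\<phi> (Sub e) \<noteq> Old y" if "e \<in> \<Union>Q1" for e using s(1)[OF that] by simp
    moreover have "\<phi> (Hub p) \<noteq> Old y" if "p \<in> Q1" for p using t(1)[OF that] by simp
    ultimately have "v \<in> Old ` verts G1" using v unfolding verts_H_insert by blast
    then show "y \<in> f ` verts G1" using v(2) f(1) by auto
  qed (use f(2) in auto)
  have sub1: "e \<subseteq> verts G1" if "e \<in> \<Union>Q1" for e
    using that quadruple_Union_subset[OF G1(2)] simple_edge_subset[OF G1(1)] by blast
  have sub2: "e \<subseteq> verts G2" if "e \<in> \<Union>Q2" for e
    using that quadruple_Union_subset[OF G2(2)] simple_edge_subset[OF G2(1)] by blast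
  \<comment> \<open>The old neighbours of a subdividing vertex are the ends of the edge that names
    it.\<close>
  have fe: "f ` e = s e" if e: "e \<in> \<Union>Q1" for e
  proof -
    have "f x \<in> s e \<longleftrightarrow> x \<in> e" if x: "x \<in> verts G1" for x
      using adj[of "Old x" "Sub e"] e x f(1)[OF x] s[OF e]
      by (simp add: verts_H_insert H_insert_adj del: Union_iff)
    moreover have "s e \<subseteq> f ` verts G1" using sub2[OF s(2)[OF e]] fV by simp
    ultimately show ?thesis using sub1[OF e] by blast
  qed
  have injP: "inj_on ((`) f) (Pow (verts G1))" using finj by (rule inj_on_image_Pow)
  \<comment> \<open>Both sides have two elements, so an inclusion is enough; it comes from the
    adjacency of hubs and subdividing vertices.\<close>
  have fp: "(`) f ` p = t p" if p: "p \<in> Q1" for p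
  proof (rule card_subset_eq)
    have "s e \<in> t p" if e: "e \<in> p" for e
    proof -
      have "\<phi> (Sub e) = Sub (s e)" using s(1) e p by blast
      moreover have "Sub e \<in> verts ?Y1" "Hub p \<in> verts ?Y1" using e p by (auto simp: verts_H_insert)
      ultimately show ?thesis using adj[of "Sub e" "Hub p"] e p t(1)[OF p] by (simp add: H_insert_adj)
    qed
    moreover have "f ` e = s e" if "e \<in> p" for e using fe p that by blast
    ultimately show "(`) f ` p \<subseteq> t p" by auto
    have "card ((`) f ` p) = card p"
      using sub1 p by (intro card_image inj_on_subset[OF injP]) blast
    then show "card ((`) f ` p) = card (t p)"
      using quadruple_pair_card[OF G1(2) p] quadruple_pair_card[OF G2(2) t(2)[OF p]] by simp
    show "finite (t p)" using quadruple_pair_card[OF G2(2) t(2)[OF p]] by (auto intro: card_ge_0_finite)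
  qed
  have Q: "(`) ((`) f) ` Q1 = Q2" using fp tQ by (metis (no_types, lifting) image_cong)
  then have U: "\<Union>Q2 = (`) f ` \<Union>Q1" by blast
  have "graph_iso f G1 G2"
  proof (rule graph_isoI[OF G1(1) G2(1)])
    show "bij_betw f (verts G1) (verts G2)" using finj fV by (simp add: bij_betw_def)
    fix x y assume xy: "x \<in> verts G1" "y \<in> verts G1"
    \<comment> \<open>Adjacency of old vertices sees only the edges outside the quadruple; the
      subdivided ones are recovered from their names.\<close>
    have "f ` {x, y} \<in> \<Union>Q2 \<longleftrightarrow> {x, y} \<in> \<Union>Q1"
      unfolding U using xy sub1 by (intro inj_on_image_mem_iff[OF injP]) auto
    then have "{f x, f y} \<in> \<Union>Q2 \<longleftrightarrow> {x, y} \<in> \<Union>Q1" by simp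
    moreover have "{f x, f y} \<in> edges G2 - \<Union>Q2 \<longleftrightarrow> {x, y} \<in> edges G1 - \<Union>Q1"
      using adj[of "Old x" "Old y"] xy f(1) by (simp add: verts_H_insert H_insert_adj del: Union_iff)
    ultimately show "{f x, f y} \<in> edges G2 \<longleftrightarrow> {x, y} \<in> edges G1"
      using quadruple_Union_subset[OF G1(2)] quadruple_Union_subset[OF G2(2)] by blast
  qed
  with Q show ?thesis using that by blast
qed

subsection \<open>The reduction\<close>

lemma triangle_free:
  assumes "enat 5 \<le> girth G" "simple_graph G" "v \<in> nbrs G u" "w \<in> nbrs G u"
  shows "w \<notin> nbrs G v"
proof
  assume "w \<in> nbrs G v"
  then have e: "{u, v} \<in> edges G" "{u, w} \<in> edges G" "{v, w} \<in> edges G" "{w, u} \<in> edges G"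
    using assms by (auto simp: nbrs_def insert_commute)
  then have "5 \<le> length [u, v, w]"
    by (intro girth_length[OF assms(1,2)]) (use simple_edgeD[OF assms(2)] in auto)
  then show False by simp
qed

lemma common_nbr_unique:
  assumes "enat 5 \<le> girth G" "simple_graph G" "u \<noteq> w"
    "v \<in> nbrs G u" "v \<in> nbrs G w" "z \<in> nbrs G u" "z \<in> nbrs G w"
  shows "v = z"
proof (rule ccontr)
  assume "v \<noteq> z"
  have e: "{u, v} \<in> edges G" "{v, w} \<in> edges G" "{w, z} \<in> edges G" "{z, u} \<in> edges G"
    using assms by (auto simp: nbrs_def insert_commute)
  then have "5 \<le> length [u, v, w, z]"
    by (intro girth_length[OF assms(1,2)])
      (use simple_edgeD(1)[OF assms(2) e(1)] simple_edgeD(1)[OF assms(2) e(2)]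
        simple_edgeD(1)[OF assms(2) e(3)] simple_edgeD(1)[OF assms(2) e(4)] \<open>v \<noteq> z\<close> \<open>u \<noteq> w\<close> in auto)
  then show False by simp
qed

text \<open>\<open>S\<close> consists of the endvertices around \<open>c\<close>, and
  \<open>d v\<close> is the edge that replaces \<open>v\<close>. Girth 5 makes \<open>d\<close>
  injective on \<open>S\<close>, with values that are pairs outside \<open>c\<close> and
  \<open>S\<close> and are not yet edges. The result keeps the vertex type of \<open>X\<close>, so
  it can be compared with the given graphs.\<close>

lemma reduction_exists:
  fixes X :: "'a graph"
  assumes cub: "cubic X" and girth: "enat 5 \<le> girth X" and good: "good_edge X c"
  obtains G :: "'a graph" and Q \<phi> where "simple_graph G" "connected_graph G" "Q \<in> edge_quadruples G"
    "graph_iso \<phi> X (H_insert G Q)" "\<phi> ` c = inserted_center Q"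
proof -
  note X = cubic_simple[OF cub]
  note tri = triangle_free[OF girth X] and four = common_nbr_unique[OF girth X]
  have c: "c \<in> edges X" and con: "connected_graph (induced X (verts X - c))"
    using good by (auto simp: good_edge_def)
  obtain a b where ab: "c = {a, b}" "a \<noteq> b" "a \<in> verts X" "b \<in> verts X" using simple_edgeE[OF X c] .
  define N where "N = nbrs X"
  have Nsym: "u \<in> N v \<longleftrightarrow> v \<in> N u" for u v unfolding N_def by (rule nbrs_sym)
  have NV: "u \<in> verts X" "u \<noteq> v" if "u \<in> N v" for u v
    using simple_edgeD[OF X] that by (auto simp: N_def nbrs_def)
  have N3: "card (N v) = 3" if "v \<in> verts X" for v
    unfolding N_def using cubic_card_nbrs[OF cub that] .
  have Nab: "b \<in> N a" "a \<in> N b" using c ab by (auto simp: N_def nbrs_def insert_commute)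
  define A where "A = N a - {b}"
  define B where "B = N b - {a}"
  define S where "S = A \<union> B"
  define d where "d v = N v - c" for v
  have cA: "card A = 2" and cB: "card B = 2"
    using N3 ab Nab finite_nbrs[OF X] by (auto simp: A_def B_def N_def)
  have AB: "A \<inter> B = {}" using tri[of b a] Nab unfolding A_def B_def N_def by auto
  have Sc: "S \<inter> c = {}" using NV(2) by (auto simp: S_def A_def B_def ab(1))
  have SV: "S \<subseteq> verts X" using NV(1) by (auto simp: S_def A_def B_def)
  have S_nbr: "v \<in> S \<longleftrightarrow> v \<in> N a \<or> v \<in> N b" if "v \<notin> c" for v
    using that by (auto simp: S_def A_def B_def ab(1))
  \<comment> \<open>Adjacent endvertices on the same side of \<open>c\<close> would form a triangle,
    on different sides a 4-cycle through \<open>c\<close>.\<close>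
  have dS: "d v \<inter> S = {}" if v: "v \<in> S" for v
  proof (rule ccontr)
    assume "d v \<inter> S \<noteq> {}"
    then obtain w where w: "w \<in> N v" "w \<in> S" by (auto simp: d_def)
    have vw: "v \<noteq> a" "v \<noteq> b" "w \<noteq> a" "w \<noteq> b" using Sc v w ab(1) by auto
    consider "v \<in> N a" "w \<in> N a" | "v \<in> N b" "w \<in> N b" | "v \<in> N a" "w \<in> N b" | "v \<in> N b" "w \<in> N a"
      using v w by (auto simp: S_def A_def B_def)
    then show False
    proof cases
      case 1 then show False using tri[of v a w] w(1) by (simp add: N_def)
    next
      case 2 then show False using tri[of v b w] w(1) by (simp add: N_def)
    next
      case 3
      then have "v = b" using four[of a w v b] vw Nab w(1) Nsym by (simp add: N_def)
      with vw show False by simp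
    next
      case 4
      then have "v = a" using four[of b w v a] vw Nab w(1) Nsym by (simp add: N_def)
      with vw show False by simp
    qed
  qed
  have dcard: "card (d v) = 2" if v: "v \<in> S" for v
  proof -
    \<comment> \<open>A vertex adjacent to both ends of \<open>c\<close> would give a triangle, so
      exactly two of its three neighbours remain.\<close>
    have "N v \<inter> c = {a} \<or> N v \<inter> c = {b}"
      using v tri[of b a v] tri[of a b v] Nab Nsym unfolding S_def A_def B_def N_def ab(1) by auto
    then have "card (N v \<inter> c) = 1" by auto
    then show ?thesis
      using N3[of v] v SV card_Diff_subset_Int[of "N v" c] finite_nbrs[OF X, of v]
      by (auto simp: d_def N_def subset_iff)
  qed
  have dV: "d v \<subseteq> verts X - c - S" if "v \<in> S" for v
    using dS[OF that] NV by (auto simp: d_def)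
  have d_two: "\<exists>u u'. d v = {u, u'} \<and> u \<noteq> u' \<and> u \<in> N v \<and> u' \<in> N v" if v: "v \<in> S" for v
  proof -
    obtain u u' where "d v = {u, u'}" "u \<noteq> u'" using dcard[OF v] by (meson card_2_iff)
    moreover then have "u \<in> N v" "u' \<in> N v" by (auto simp: d_def)
    ultimately show ?thesis by blast
  qed
  have dinj: "inj_on d S"
  proof (rule inj_onI, rule ccontr)
    fix v w assume vw: "v \<in> S" "w \<in> S" "d v = d w" "v \<noteq> w"
    obtain u u' where u: "d v = {u, u'}" "u \<noteq> u'" "u \<in> N v" "u' \<in> N v" using d_two[OF vw(1)] by metis
    then have "u \<in> N w" "u' \<in> N w" using vw(3) by (auto simp: d_def)
    then show False using four[of v w u u'] u vw(4) by (simp add: N_def)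
  qed
  \<comment> \<open>Because of this, taking the new edges out of \<open>G\<close> again returns
    exactly the edges of \<open>X\<close> inside \<open>W\<close>.\<close>
  have dE: "d v \<notin> edges X" if v: "v \<in> S" for v
  proof
    assume "d v \<in> edges X"
    moreover obtain u u' where "d v = {u, u'}" "u \<in> N v" "u' \<in> N v" using d_two[OF v] by metis
    ultimately show False using tri[of u v u'] by (auto simp: N_def nbrs_def)
  qed
  define W where "W = verts X - c - S"
  define G where "G = Graph W ({e \<in> edges X. e \<subseteq> W} \<union> d ` S)"
  define Q where "Q = {d ` A, d ` B}"
  have UQ: "\<Union>Q = d ` S" by (auto simp: Q_def S_def)
  have G: "simple_graph G"
    using X dV dcard by (auto simp: simple_graph_def G_def W_def)
  have Q: "Q \<in> edge_quadruples G"
  proof -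
    obtain v1 v2 v3 v4 where v: "A = {v1, v2}" "v1 \<noteq> v2" "B = {v3, v4}" "v3 \<noteq> v4"
      using cA cB by (meson card_2_iff)
    then have "distinct [v1, v2, v3, v4]" "set [v1, v2, v3, v4] = S" using AB by (auto simp: S_def)
    then have "distinct (map d [v1, v2, v3, v4])" using dinj by (simp only: distinct_map)
    moreover have "Q = {{d v1, d v2}, {d v3, d v4}}" by (simp add: Q_def v)
    moreover have "{d v1, d v2, d v3, d v4} \<subseteq> edges G" by (auto simp: G_def S_def v)
    ultimately show ?thesis using quadrupleI by (simp only: list.map)
  qed
  have AS: "A \<subseteq> S" and BS: "B \<subseteq> S" by (auto simp: S_def)
  have pAB: "d ` A \<noteq> d ` B"
  proof -
    have "A \<noteq> B" using AB cA by auto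
    then show ?thesis using inj_on_image_eq_iff[OF dinj AS BS] by simp
  qed
  define \<phi> where "\<phi> x = (if x = a then Hub (d ` A) else if x = b then Hub (d ` B)
      else if x \<in> S then Sub (d x) else Old x)" for x
  have \<phi>: "\<phi> a = Hub (d ` A)" "\<phi> b = Hub (d ` B)" "\<And>x. x \<in> S \<Longrightarrow> \<phi> x = Sub (d x)"
    "\<And>x. x \<in> W \<Longrightarrow> \<phi> x = Old x"
    using ab Sc by (auto simp: \<phi>_def W_def)
  have VX: "verts X = {a, b} \<union> S \<union> W" using ab SV by (auto simp: W_def)
  have iso: "graph_iso \<phi> X (H_insert G Q)"
  proof (rule graph_isoI[OF X simple_H_insert[OF G Q]])
    show "bij_betw \<phi> (verts X) (verts (H_insert G Q))"
      unfolding bij_betw_def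
    proof
      show "inj_on \<phi> (verts X)"
      proof (rule inj_onI)
        fix x y assume "x \<in> verts X" "y \<in> verts X" "\<phi> x = \<phi> y"
        then show "x = y"
          using pAB inj_onD[OF dinj] by (auto simp: \<phi>_def split: if_splits)
      qed
      have "\<phi> ` S = Sub ` d ` S" "\<phi> ` W = Old ` W" using \<phi>(3,4) by (auto simp: image_iff)
      then show "\<phi> ` verts X = verts (H_insert G Q)"
        unfolding VX image_Un verts_H_insert UQ by (auto simp: \<phi> Q_def G_def)
    qed
    have adj: "{x, y} \<in> edges X \<longleftrightarrow> y \<in> N x" for x y by (simp add: N_def nbrs_def)
    have no_loop: "x \<notin> N x" for x using NV(2)[of x x] by auto
    have hh: "{Hub p} \<notin> edges (H_insert G Q)" for p
      using H_insert_Hub_Hub[of p p G Q] pAB by (auto simp: Q_def)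
    have hs: "{Hub (d ` Z), Sub (d y)} \<in> edges (H_insert G Q) \<longleftrightarrow> y \<in> Z"
      if "y \<in> S" "Z = A \<or> Z = B" for y Z
      using that inj_on_image_mem_iff[OF dinj, of y Z] AS BS
      by (auto simp: H_insert_adj' Q_def)
    have so: "{Sub (d x), Old y} \<in> edges (H_insert G Q) \<longleftrightarrow> y \<in> N x"
      if "x \<in> S" "y \<in> W" for x y
      using that unfolding H_insert_adj' UQ by (auto simp: d_def W_def)
    have oo: "{Old x, Old y} \<in> edges (H_insert G Q) \<longleftrightarrow> y \<in> N x" if "x \<in> W" "y \<in> W" for x y
      using that dE unfolding H_insert_adj UQ adj[symmetric] by (auto simp: G_def)
    have ss: "y \<notin> N x" if "x \<in> S" "y \<in> S" for x y
      using dS[OF that(1)] that Sc by (auto simp: d_def)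
    have aS: "y \<in> N a \<longleftrightarrow> y \<in> A" "y \<in> N b \<longleftrightarrow> y \<in> B" if "y \<in> S" for y
      using that Sc by (auto simp: A_def B_def ab(1))
    have aW: "y \<notin> N a" "y \<notin> N b" if "y \<in> W" for y
      using that S_nbr[of y] by (auto simp: W_def)
    \<comment> \<open>Adjacency is symmetric, so it suffices to treat one order for each pair of
      kinds of vertices.\<close>
    define le where "le x y \<longleftrightarrow> x = a \<and> y = b \<or> x \<in> {a, b} \<and> y = x \<or> x \<in> {a, b} \<and> y \<in> S \<or>
        x \<in> {a, b} \<and> y \<in> W \<or> x \<in> S \<and> y \<in> S \<or> x \<in> S \<and> y \<in> W \<or> x \<in> W \<and> y \<in> W" for x y
    have half: "{\<phi> x, \<phi> y} \<in> edges (H_insert G Q) \<longleftrightarrow> y \<in> N x"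
      if "le x y" for x y
      using that unfolding le_def
    proof (elim disjE conjE)
      assume "x = a" "y = b" then show ?thesis using Nab by (simp add: \<phi> H_insert_adj Q_def)
    next
      assume "x \<in> {a, b}" "y = x" then show ?thesis
        using no_loop hh by (auto simp: \<phi> H_insert_adj)
    next
      assume "x \<in> {a, b}" "y \<in> S" then show ?thesis
        using hs aS by (auto simp: \<phi>)
    next
      assume "x \<in> {a, b}" "y \<in> W" then show ?thesis
        using aW by (auto simp: \<phi> H_insert_adj')
    next
      assume "x \<in> S" "y \<in> S" then show ?thesis using ss by (simp add: \<phi> H_insert_adj)
    next
      assume "x \<in> S" "y \<in> W" then show ?thesis using so by (simp add: \<phi>)
    next
      assume "x \<in> W" "y \<in> W" then show ?thesis using oo by (simp add: \<phi>)
    qed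
    fix x y assume "x \<in> verts X" "y \<in> verts X"
    then have xy: "x \<in> {a, b} \<union> S \<union> W" "y \<in> {a, b} \<union> S \<union> W" unfolding VX .
    then have "x = a \<or> x = b \<or> x \<in> S \<or> x \<in> W" "y = a \<or> y = b \<or> y \<in> S \<or> y \<in> W" by auto
    then have "le x y \<or> le y x" unfolding le_def by (elim disjE) simp_all
    then show "{\<phi> x, \<phi> y} \<in> edges (H_insert G Q) \<longleftrightarrow> {x, y} \<in> edges X"
      using half[of x y] half[of y x] Nsym[of x y] adj[of x y] insert_commute[of "\<phi> y" "\<phi> x" "{}"]
      by metis
  qed
  have conG: "connected_graph G"
  proof (subst connected_graph_iff[OF G], intro conjI allI impI)
    obtain v where v: "v \<in> A" using cA by (metis card.empty ex_in_conv zero_neq_numeral)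
    then have "v \<in> S" by (simp add: S_def)
    then have "card (d v) = 2" "d v \<subseteq> W" using dcard dV by (auto simp: W_def)
    then have "d v \<noteq> {}" "d v \<subseteq> W" by auto
    then show "verts G \<noteq> {}" by (auto simp: G_def)
    fix Z assume Z: "Z \<subseteq> verts G \<and> Z \<noteq> {} \<and> (\<forall>x\<in>Z. \<forall>y. {x, y} \<in> edges G \<longrightarrow> y \<in> Z)"
    then have Zne: "Z \<noteq> {}" and Zcl: "\<And>x y. x \<in> Z \<Longrightarrow> {x, y} \<in> edges G \<Longrightarrow> y \<in> Z"
      by blast+
    have ZW: "Z \<subseteq> W" using Z by (simp add: G_def)
    \<comment> \<open>The edge \<open>d v\<close> of \<open>G\<close> stands for the path through
      \<open>v\<close> in \<open>X\<close> without \<open>c\<close>. Adding the endvertices whose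
      new edge meets \<open>Z\<close> turns a closed set of \<open>G\<close> into a closed set of
      the graph that goodness makes connected.\<close>
    define Z' where "Z' = Z \<union> {v \<in> S. d v \<inter> Z \<noteq> {}}"
    have closed: "d v \<subseteq> Z" if v: "v \<in> S" "d v \<inter> Z \<noteq> {}" for v
    proof -
      obtain u u' where u: "d v = {u, u'}" using d_two[OF v(1)] by metis
      then have "{u, u'} \<in> edges G" "{u', u} \<in> edges G" using v(1) by (auto simp: G_def insert_commute)
      then show ?thesis using u v(2) Zcl by auto
    qed
    have "Z' = verts (induced X (verts X - c))"
    proof (rule con[unfolded connected_graph_iff[OF simple_induced[OF X]], THEN conjunct2, rule_format],
        intro conjI ballI allI impI)
      show "Z' \<subseteq> verts (induced X (verts X - c))"
        using ZW SV Sc by (auto simp: Z'_def induced_def W_def)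
      show "Z' \<noteq> {}" using Zne by (auto simp: Z'_def)
      fix x y assume x: "x \<in> Z'" and "{x, y} \<in> edges (induced X (verts X - c))"
      then have xy: "{x, y} \<in> edges X" "y \<in> verts X - c" "x \<in> verts X - c" by (auto simp: induced_def)
      then have yN: "y \<in> N x" "x \<in> N y" using Nsym by (auto simp: N_def nbrs_def)
      show "y \<in> Z'"
      proof (cases "x \<in> Z")
        case True
        show ?thesis
        proof (cases "y \<in> S")
          case True
          then show ?thesis using \<open>x \<in> Z\<close> yN(2) xy(3) by (auto simp: Z'_def d_def)
        next
          case False
          then have "{x, y} \<in> edges G" using xy True ZW by (auto simp: G_def W_def)
          then show ?thesis using Zcl[OF True] by (simp add: Z'_def)
        qed
      next
        case False
        then have "d x \<subseteq> Z" using x closed by (auto simp: Z'_def)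
        then show ?thesis using yN(1) xy(2) by (auto simp: Z'_def d_def)
      qed
    qed
    then have "W \<subseteq> Z'" by (auto simp: induced_def W_def)
    then show "Z = verts G" using ZW by (auto simp: Z'_def G_def W_def)
  qed
  have "\<phi> ` c = inserted_center Q" by (simp add: ab(1) \<phi> inserted_center_def Q_def)
  with G conG Q iso show ?thesis by (rule that)
qed

subsection \<open>Generation of the target class\<close>

lemma target_class_iso:
  assumes "graph_iso f X Y" "target_class k n X"
  shows "target_class k n Y"
proof -
  have X: "cubic X" "simple_graph X" using assms(2) cubic_simple by (auto simp: target_class_def)
  show ?thesis
    using assms(2) iso_connected[OF assms(1) X(2)] iso_cubic[OF assms(1) X(2) X(1)]
      iso_card_verts[OF assms(1) X(2)] iso_girth[OF assms(1) X(2)]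
    by (simp add: target_class_def)
qed

lemma girth_mono: "enat k \<le> girth G \<Longrightarrow> 5 \<le> k \<Longrightarrow> enat 5 \<le> girth G"
  using order.trans[of "enat 5" "enat k"] by simp

lemma parent_class_reduced:
  assumes G: "simple_graph G" "Q \<in> edge_quadruples G" and con: "connected_graph G"
    and t: "target_class k n (H_insert G Q)" and k: "k \<ge> 5"
  shows "parent_class k n G"
proof -
  have girth: "enat k \<le> girth (H_insert G Q)" and "cubic (H_insert G Q)"
    and card: "int (card (verts (H_insert G Q))) = n"
    using t by (auto simp: target_class_def)
  then have "cubic G" using cubic_H_insert_iff[OF G] by simp
  moreover have "int (card (verts G)) = n - 6" using card card_verts_H_insert[OF G] by simp
  ultimately show ?thesis
    using con girth_reduced[OF G girth k] deficit_reduced[OF G girth]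
    unfolding parent_class_def by simp
qed

text \<open>The last two components of the tuple determine the orbit of the centre.\<close>

lemma minimal_centers_iso:
  assumes lab: "canonical_labelling lab" and X: "simple_graph X" and Y: "simple_graph Y"
    and iso: "graph_iso \<phi> X Y"
    and c: "minimal_reducible_H lab X T c" and c': "minimal_reducible_H lab Y T' c'"
  obtains \<psi> where "graph_iso \<psi> X Y" "\<psi> ` c = c'"
proof -
  have red: "reducible_H X T c" "reducible_H Y T' c'" using c c' by (auto simp: minimal_reducible_H_def)
  have cX: "c \<in> edges X" "c' \<in> edges Y" using red by (auto simp: reducible_H_def good_edge_def)
  note cV = simple_edge_subset[OF X cX(1)]
  note tup = iso_H_tuple[OF lab iso X cV]
  \<comment> \<open>An isomorphism carries a reducible H to a reducible H, so each transported
    centre competes on the other side. With invariance of the tuple this gives both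
    inequalities.\<close>
  have "H_tuple lab Y c' \<le> H_tuple lab Y (\<phi> ` c)"
    using c' iso_reducible_H[OF iso X red(1)] unfolding minimal_reducible_H_def by blast
  moreover obtain \<rho> where \<rho>: "graph_iso \<rho> Y X" using graph_iso_inverse[OF iso X] by metis
  have "H_tuple lab X c \<le> H_tuple lab X (\<rho> ` c')"
    using c iso_reducible_H[OF \<rho> Y red(2)] unfolding minimal_reducible_H_def by blast
  then have "H_tuple lab Y (\<phi> ` c) \<le> H_tuple lab Y c'"
    using tup iso_H_tuple[OF lab \<rho> Y simple_edge_subset[OF Y cX(2)]] by simp
  ultimately have "H_tuple lab Y (\<phi> ` c) = H_tuple lab Y c'" by (rule antisym[rotated])
  then have "orbit_label (lab Y) Y (\<phi> ` c) = orbit_label (lab Y) Y c'"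
    by (simp add: H_tuple_def prod_eq_iff)
  moreover have "\<phi> ` c \<in> edges Y" using cX(1) by (simp add: graph_iso_edges[OF iso])
  ultimately obtain \<alpha> where \<alpha>: "graph_iso \<alpha> Y Y" "\<alpha> ` \<phi> ` c = c'"
    using orbit_label_eq[OF lab Y _ cX(2)] by metis
  have "(\<alpha> \<circ> \<phi>) ` c = c'" using \<alpha>(2) by (simp add: image_image)
  with graph_iso_comp[OF iso \<alpha>(1)] show ?thesis using that by blast
qed

theorem theorem11:
  fixes k :: nat and n :: int
    and lab :: "'a xvertex graph \<Rightarrow> 'a xvertex \<Rightarrow> nat"
    and L :: "'a graph set"
    and R :: "'a graph \<Rightarrow> 'a set set set set"
  assumes inf: "infinite (UNIV :: 'a set)"
    and k: "k \<ge> 5"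
    and lab: "canonical_labelling lab"
    and given_class: "\<forall>G\<in>L. parent_class k n G"
    and given_reps: "\<forall>X :: 'a graph. parent_class k n X \<longrightarrow> (\<exists>!G. G \<in> L \<and> isomorphic G X)"
    and quads_eligible: "\<forall>G\<in>L. \<forall>Q\<in>R G. eligible k G Q"
    and quads_reps: "\<forall>G\<in>L. \<forall>Q. eligible k G Q \<longrightarrow>
           (\<exists>!Q'. Q' \<in> R G \<and> equivalent_quadruples G Q Q')"
  shows "(\<forall>(G, Q) \<in> accepted lab n L R. target_class k n (H_insert G Q)) \<and>
         (\<forall>X :: 'b graph. target_class k n X \<longrightarrow>
            (\<exists>!z. z \<in> accepted lab n L R \<and> isomorphic (H_insert (fst z) (snd z)) X))"
proof -
  have cubicL: "cubic G" if "G \<in> L" for G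
    using given_class that by (auto simp: parent_class_def)
  have simpleL: "simple_graph G" if "G \<in> L" for G
    using cubic_simple[OF cubicL[OF that]] .
  have acc: "G \<in> L" "simple_graph G" "Q \<in> R G" "Q \<in> edge_quadruples G" "eligible k G Q"
      "minimal_reducible_H lab (H_insert G Q) (inserted_H Q) (inserted_center Q)"
      "int (card (verts (H_insert G Q))) = n"
    if "(G, Q) \<in> accepted lab n L R" for G Q
    using that quads_eligible simpleL by (auto simp: accepted_def eligible_def)
  have target: "target_class k n (H_insert G Q)" if z: "(G, Q) \<in> accepted lab n L R" for G Q
  proof -
    note a = acc[OF z]
    have "good_edge (H_insert G Q) (inserted_center Q)"
      using a(6) by (auto simp: minimal_reducible_H_def reducible_H_def)
    \<comment> \<open>Connectivity is read off from the centre of the accepted H, regularity from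
      the given graph, and girth from eligibility.\<close>
    from connected_H_insert[OF a(2,4) this] show ?thesis
      using a cubicL[OF a(1)] cubic_H_insert_iff[OF a(2,4)] by (simp add: target_class_def eligible_def)
  qed
  have unique: "(G1, Q1) = (G2, Q2)"
    if z1: "(G1, Q1) \<in> accepted lab n L R" and z2: "(G2, Q2) \<in> accepted lab n L R"
      and iso: "isomorphic (H_insert G1 Q1) (H_insert G2 Q2)" for G1 Q1 G2 Q2
  proof -
    note a1 = acc[OF z1] and a2 = acc[OF z2]
    note Y1 = simple_H_insert[OF a1(2,4)] and Y2 = simple_H_insert[OF a2(2,4)]
    obtain \<phi> where "graph_iso \<phi> (H_insert G1 Q1) (H_insert G2 Q2)" using iso by (auto simp: isomorphic_def)
    then obtain \<psi> where "graph_iso \<psi> (H_insert G1 Q1) (H_insert G2 Q2)"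
      "\<psi> ` inserted_center Q1 = inserted_center Q2"
      using minimal_centers_iso[OF lab Y1 Y2 _ a1(6) a2(6)] by metis
    then obtain f where f: "graph_iso f G1 G2" "(`) ((`) f) ` Q1 = Q2"
      using H_insert_iso_descends[OF a1(2,4) a2(2,4)] by metis
    have "isomorphic G1 G2" "isomorphic G2 G2" using f graph_iso_id by (auto simp: isomorphic_def)
    \<comment> \<open>Both graphs represent the class of \<open>G2\<close>, which is itself in the
      parent class.\<close>
    then have G: "G1 = G2" using given_reps given_class a1(1) a2(1) by metis
    have "equivalent_quadruples G1 Q1 Q2"
      using f unfolding G equivalent_quadruples_def automorphisms_def by blast
    \<comment> \<open>By reflexivity and by \<open>f\<close>, both quadruples represent the class of
      \<open>Q1\<close>.\<close>
    moreover have "equivalent_quadruples G1 Q1 Q1"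
      unfolding equivalent_quadruples_def automorphisms_def
      by (intro bexI[of _ id]) (simp_all add: graph_iso_id)
    ultimately have "Q1 = Q2" using quads_reps a1(1,3,5) a2(3) G by metis
    with G show ?thesis by simp
  qed
  have exist: "\<exists>G Q. (G, Q) \<in> accepted lab n L R \<and> isomorphic (H_insert G Q) X"
    if X: "target_class k n X" for X :: "'b graph"
  proof -
    have sX: "simple_graph X" using X cubic_simple by (auto simp: target_class_def)
    \<comment> \<open>The reduction must live on the vertex type of the given graphs. That type is
      infinite, so it has room for a copy of the finite graph \<open>X\<close>.\<close>
    obtain g :: "'b \<Rightarrow> 'a" where "inj_on g (verts X)"
    proof -
      obtain B :: "'a set" where B: "finite B" "card B = card (verts X)"
        using infinite_arbitrarily_large[OF inf] by metis
      have "finite (verts X)" using sX by (simp add: simple_graph_def)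
      from finite_same_card_bij[OF this B(1) B(2)[symmetric]] show ?thesis
        using that by (auto simp: bij_betw_def)
    qed
    then have isoZ: "graph_iso g X (relabel g X)" by (rule graph_iso_relabel)
    define Z where "Z = relabel g X"
    have Z: "target_class k n Z" using target_class_iso[OF isoZ X] by (simp add: Z_def)
    have cZ: "cubic Z" and conZ: "connected_graph Z" and gZ: "enat 5 \<le> girth Z"
      using Z girth_mono[OF _ k] by (auto simp: target_class_def)
    note sZ = cubic_simple[OF cZ]
    \<comment> \<open>\<open>lab\<close> applies only to graphs on the type
      \<open>'a xvertex\<close>, so tuples of edges of \<open>Z\<close> are computed on this
      copy.\<close>
    let ?Z = "relabel Old Z"
    have isoO: "graph_iso Old Z ?Z" by (rule graph_iso_relabel) (simp add: inj_on_def)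
    let ?t = "\<lambda>c. H_tuple lab ?Z (Old ` c)"
    obtain c0 where "good_edge Z c0" using good_edge_exists[OF cZ conZ] by blast
    \<comment> \<open>The lexicographic order on tuples is a well-order, so a least value exists.
      Minimising over all good edges suffices because the centre of every reducible H is
      good.\<close>
    then obtain c where c: "good_edge Z c" and cmin: "\<And>c'. good_edge Z c' \<Longrightarrow> ?t c \<le> ?t c'"
      using exists_least_iff[of "\<lambda>v. \<exists>c. good_edge Z c \<and> v = ?t c"] by (metis not_le)
    obtain G0 :: "'a graph" and Q0 \<phi> where G0: "simple_graph G0" "connected_graph G0" "Q0 \<in> edge_quadruples G0"
      and \<phi>: "graph_iso \<phi> Z (H_insert G0 Q0)" "\<phi> ` c = inserted_center Q0"
      using reduction_exists[OF cZ gZ c] by metis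
    have "parent_class k n G0"
      using parent_class_reduced[OF G0(1,3,2) target_class_iso[OF \<phi>(1) Z] k] .
    then obtain G where G: "G \<in> L" "isomorphic G G0" using given_reps by metis
    note sG = simpleL[OF G(1)]
    obtain f where f: "graph_iso f G0 G" using isomorphic_sym[OF sG G(2)] by (auto simp: isomorphic_def)
    define Q1 where "Q1 = (`) ((`) f) ` Q0"
    have Q1: "Q1 \<in> edge_quadruples G" using iso_quadruple[OF f G0(1,3)] by (simp add: Q1_def)
    have \<phi>1: "graph_iso (xmap f \<circ> \<phi>) Z (H_insert G Q1)"
      using graph_iso_comp[OF \<phi>(1) iso_H_insert[OF f G0(1,3)]] by (simp add: Q1_def)
    have "(xmap f \<circ> \<phi>) ` c = xmap f ` \<phi> ` c" by (simp add: image_image)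
    then have c1: "(xmap f \<circ> \<phi>) ` c = inserted_center Q1"
      using \<phi>(2) xmap_center[of f Q0] by (simp add: Q1_def)
    have "eligible k G Q1"
      using Q1 target_class_iso[OF \<phi>1 Z] by (simp add: eligible_def target_class_def)
    \<comment> \<open>\<open>Q1\<close> need not be the chosen representative of its class; an
      automorphism of \<open>G\<close> moves it, and with it the centre, to one that is.\<close>
    then obtain Q where Q: "Q \<in> R G" "equivalent_quadruples G Q1 Q" using quads_reps G(1) by metis
    then obtain h where h: "graph_iso h G G" "(`) ((`) h) ` Q1 = Q"
      by (auto simp: equivalent_quadruples_def automorphisms_def)
    define \<psi> where "\<psi> = xmap h \<circ> (xmap f \<circ> \<phi>)"
    have \<psi>: "graph_iso \<psi> Z (H_insert G Q)"
      using graph_iso_comp[OF \<phi>1 iso_H_insert[OF h(1) sG Q1]] h(2) by (simp add: \<psi>_def)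
    have c\<psi>: "\<psi> ` c = inserted_center Q"
    proof -
      have "\<psi> ` c = xmap h ` (xmap f \<circ> \<phi>) ` c" by (simp add: \<psi>_def image_image)
      also have "\<dots> = inserted_center Q" using c1 xmap_center[of h Q1] h(2) by simp
      finally show ?thesis .
    qed
    have qQ: "Q \<in> edge_quadruples G" using iso_quadruple[OF h(1) sG Q1] h(2) by simp
    let ?Y = "H_insert G Q"
    have tY: "target_class k n ?Y" using target_class_iso[OF \<psi> Z] .
    have sY: "simple_graph ?Y" using simple_H_insert[OF sG qQ] .
    have red: "reducible_H ?Y (inserted_H Q) (inserted_center Q)"
    proof (rule reducible_inserted_H[OF sG qQ])
      show "enat 5 \<le> girth ?Y" using girth_mono[OF _ k] tY by (auto simp: target_class_def)
      show "good_edge ?Y (inserted_center Q)" using iso_good_edge[OF \<psi> sZ c] by (simp add: c\<psi>)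
    qed
    obtain \<chi> where \<chi>: "graph_iso \<chi> ?Y Z" "\<And>y. y \<in> verts ?Y \<Longrightarrow> \<psi> (\<chi> y) = y"
      "\<And>x. x \<in> verts Z \<Longrightarrow> \<chi> (\<psi> x) = x"
      using graph_iso_inverse[OF \<psi> sZ] by metis
    \<comment> \<open>Invariance of the tuple moves the comparison from the expanded graph back to
      \<open>Z\<close>, where \<open>c\<close> was chosen.\<close>
    have tuple: "H_tuple lab ?Y d = ?t (\<chi> ` d)" if "d \<in> edges ?Y" for d
      using iso_H_tuple[OF lab graph_iso_comp[OF \<chi>(1) isoO] sY simple_edge_subset[OF sY that]]
      by (simp add: image_image)
    have "\<chi> ` \<psi> ` c = c"
    proof -
      have "c \<subseteq> verts Z" using c simple_edge_subset[OF sZ] by (auto simp: good_edge_def)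
      then show ?thesis using \<chi>(3) by force
    qed
    then have "\<chi> ` inserted_center Q = c" by (simp add: c\<psi>)
    moreover have "H_tuple lab ?Y (inserted_center Q) \<le> H_tuple lab ?Y c'" if "reducible_H ?Y T' c'" for T' c'
    proof -
      have g: "good_edge ?Y c'" "good_edge ?Y (inserted_center Q)"
        using that red by (auto simp: reducible_H_def)
      then have "c' \<in> edges ?Y" "inserted_center Q \<in> edges ?Y" by (auto simp: good_edge_def)
      then show ?thesis
        using tuple cmin[OF iso_good_edge[OF \<chi>(1) sY g(1)]] \<open>\<chi> ` inserted_center Q = c\<close> by simp
    qed
    ultimately have "minimal_reducible_H lab ?Y (inserted_H Q) (inserted_center Q)"
      using red by (auto simp: minimal_reducible_H_def)
    then have "(G, Q) \<in> accepted lab n L R"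
      using G(1) Q(1) tY by (simp add: accepted_def target_class_def)
    moreover have "isomorphic ?Y X"
    proof -
      have "isomorphic X ?Y"
        using graph_iso_comp[OF isoZ \<psi>[unfolded Z_def]] by (auto simp: isomorphic_def)
      then show ?thesis using isomorphic_sym[OF sX] by blast
    qed
    ultimately show ?thesis by blast
  qed
  show ?thesis
  proof (intro conjI allI impI)
    show "\<forall>(G, Q) \<in> accepted lab n L R. target_class k n (H_insert G Q)" using target by blast
    fix X :: "'b graph" assume X: "target_class k n X"
    obtain G Q where z: "(G, Q) \<in> accepted lab n L R" "isomorphic (H_insert G Q) X"
      using exist[OF X] by blast
    show "\<exists>!z. z \<in> accepted lab n L R \<and> isomorphic (H_insert (fst z) (snd z)) X"
    proof (rule ex1I[of _ "(G, Q)"])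
      show "(G, Q) \<in> accepted lab n L R \<and> isomorphic (H_insert (fst (G, Q)) (snd (G, Q))) X"
        using z by simp
      fix z' assume z': "z' \<in> accepted lab n L R \<and> isomorphic (H_insert (fst z') (snd z')) X"
      obtain G' Q' where eq: "z' = (G', Q')" by force
      have "isomorphic X (H_insert G Q)"
        using isomorphic_sym[OF _ z(2)] simple_H_insert acc(2,4)[OF z(1)] by blast
      then have "isomorphic (H_insert G' Q') (H_insert G Q)"
        using z' eq isomorphic_trans by fastforce
      then show "z' = (G, Q)" using unique z(1) z' eq by blast
    qed
  qed
qed

end
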